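(* Let $n\ge2$ be an integer, and equip subsets of $n^{<\omega}$ with the extension (initial segment) ordering. (a) If $A\subseteq n^{<\omega}$ is an antichain, then one of the following holds: $A^\infty=\emptyset$; $A^\infty=n^\omega$; $A^\infty\in\mathbf{\Pi}^0_1\setminus\mathbf{\Sigma}^0_1$; $A^\infty\in\Pi^0_2(A)\setminus\mathbf{\Sigma}^0_2$. Moreover, each of these four cases is realized by some antichain $A$. (b) If all antichains contained in $A\subseteq n^{<\omega}$ are finite, then $A^\infty\in\mathbf{\Pi}^0_2$; and $A^\infty$ is not $\mathbf{\Sigma}^0_2$ in general, i.e. there is such an $A$ with $A^\infty\notin\mathbf{\Sigma}^0_2$.
   Context: $n=\{0,\dots,n-1\}$ is a finite alphabet, $n^{<\omega}$ is the set of finite words over it, and $n^\omega$ has the product topology. For $A\subseteq n^{<\omega}$, $A^\infty:=\{a_0a_1a_2\ldots\in n^\omega : \forall i\in\omega\ a_i\in A\}$. An antichain is a set of words no two distinct elements of which are comparable for the initial segment relation. $\Pi^0_2(A)$ denotes the lightface class $\Pi^0_2$ relativized to $A$ (with $n^{<\omega}$ identified with $\omega$ by a fixed recursive bijection); boldface letters denote the usual Borel classes in $n^\omega$. *)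

theory Defs
  imports "HOL-Analysis.Analysis" "HOL-Library.Sublist"
begin

section \<open>Finite and infinite words over the alphabet {0, ..., n - 1}\<close>

text \<open>
  The set of finite words is \<open>lists {..<n}\<close>.  An infinite word is a function on the naturals
  with values below \<open>n\<close>.
\<close>

definition omega_words :: "nat \<Rightarrow> (nat \<Rightarrow> nat) topology" where
  "omega_words n = product_topology (\<lambda>_. discrete_topology {..<n}) UNIV"

definition restr :: "(nat \<Rightarrow> nat) \<Rightarrow> nat \<Rightarrow> nat list" where
  "restr \<alpha> k = map \<alpha> [0..<k]"

text \<open>
  \<open>\<alpha>\<close> is the concatenation \<open>a 0 @ a 1 @ a 2 @ \<dots>\<close>.  The second clause forces that concatenation to be
  infinite; it matters only if almost all of the \<open>a i\<close> are empty, in which case no \<open>\<alpha>\<close> qualifies.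
\<close>

definition is_inf_concat :: "(nat \<Rightarrow> nat list) \<Rightarrow> (nat \<Rightarrow> nat) \<Rightarrow> bool" where
  "is_inf_concat a \<alpha> \<longleftrightarrow>
     (\<forall>i. let w = concat (map a [0..<i]) in w = restr \<alpha> (length w)) \<and>
     (\<forall>k. \<exists>i. k \<le> length (concat (map a [0..<i])))"

definition omega_power :: "nat list set \<Rightarrow> (nat \<Rightarrow> nat) set" where
  "omega_power A = {\<alpha>. \<exists>a. (\<forall>i. a i \<in> A) \<and> is_inf_concat a \<alpha>}"

definition word_antichain :: "nat list set \<Rightarrow> bool" where
  "word_antichain A \<longleftrightarrow> pairwise (\<parallel>) A"


section \<open>Relative recursiveness and the lightface classes\<close>

text \<open>
  \<open>recursive_in Z k f\<close>: the \<open>k\<close>-ary total function \<open>f\<close>, applied to argument lists of length \<open>k\<close>,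
  is general recursive relative to the oracle \<open>Z\<close>.  Values on lists of other lengths are irrelevant.
  Only regular minimization is used, so all functions are total.
\<close>

inductive recursive_in :: "nat set \<Rightarrow> nat \<Rightarrow> (nat list \<Rightarrow> nat) \<Rightarrow> bool" for Z :: "nat set" where
  zero: "recursive_in Z k (\<lambda>xs. 0)"
| succ: "recursive_in Z 1 (\<lambda>xs. Suc (xs ! 0))"
| proj: "i < k \<Longrightarrow> recursive_in Z k (\<lambda>xs. xs ! i)"
| oracle_query: "recursive_in Z 1 (\<lambda>xs. if xs ! 0 \<in> Z then 1 else 0)"
| comp: "recursive_in Z (length gs) f \<Longrightarrow> (\<forall>g \<in> set gs. recursive_in Z k g) \<Longrightarrow>
    recursive_in Z k (\<lambda>xs. f (map (\<lambda>g. g xs) gs))"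
| prim_rec: "recursive_in Z k f \<Longrightarrow> recursive_in Z (Suc (Suc k)) g \<Longrightarrow>
    recursive_in Z (Suc k) (\<lambda>xs. rec_nat (f (tl xs)) (\<lambda>y r. g (y # r # tl xs)) (hd xs))"
| mu: "recursive_in Z (Suc k) g \<Longrightarrow> (\<forall>xs. length xs = k \<longrightarrow> (\<exists>y. g (y # xs) = 0)) \<Longrightarrow>
    recursive_in Z k (\<lambda>xs. LEAST y. g (y # xs) = 0)"

text \<open>
  The recursive bijection between finite words and natural numbers: bijective base-\<open>n\<close> numeration,
  least significant letter first.
\<close>

fun word_code :: "nat \<Rightarrow> nat list \<Rightarrow> nat" where
  "word_code n [] = 0"
| "word_code n (x # xs) = Suc (x + n * word_code n xs)"

lemma bij_betw_word_code:
  assumes "0 < n"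
  shows "bij_betw (word_code n) (lists {..<n}) UNIV"
proof -
  have inj: "u = v" if "u \<in> lists {..<n}" "v \<in> lists {..<n}" "word_code n u = word_code n v" for u v
    using that
  proof (induction u arbitrary: v rule: list.induct)
    case Nil
    then show ?case by (cases v) auto
  next
    case (Cons x u)
    obtain y v' where v: "v = y # v'"
      using Cons.prems by (cases v) auto
    have eq: "x + n * word_code n u = y + n * word_code n v'" and lt: "x < n" "y < n"
      using Cons.prems by (simp_all add: v)
    have "x = y"
      using arg_cong[OF eq, of "\<lambda>m. m mod n"] lt by simp
    moreover have "word_code n u = word_code n v'"
      using eq \<open>x = y\<close> assms by simp
    ultimately show ?case
      using Cons v by auto
  qed
  have surj: "\<exists>u \<in> lists {..<n}. word_code n u = m" for m
  proof (induction m rule: less_induct)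
    case (less m)
    show ?case
    proof (cases m)
      case 0
      then show ?thesis by (intro bexI[of _ "[]"]) auto
    next
      case (Suc k)
      have "k div n < m"
        using Suc div_le_dividend[of k n] by linarith
      then obtain u where u: "u \<in> lists {..<n}" "word_code n u = k div n"
        using less by blast
      show ?thesis
        using u Suc assms by (intro bexI[of _ "(k mod n) # u"]) auto
    qed
  qed
  show ?thesis
    unfolding bij_betw_def inj_on_def using inj surj by (auto simp: image_iff) metis
qed

text \<open>
  Lightface classes relativized to \<open>A\<close>, a set of finite words.  A subset \<open>P\<close> of the product of the
  naturals with the infinite words is \<open>\<Sigma>\<^sup>0\<^sub>1(A)\<close> if it is given by a relation recursive in \<open>A\<close>
  on finite restrictions; a set is \<open>\<Pi>\<^sup>0\<^sub>2(A)\<close> if it is the universal number projection of such a \<open>P\<close>.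
\<close>

definition lightface_Sigma01 :: "nat \<Rightarrow> nat list set \<Rightarrow> (nat \<times> (nat \<Rightarrow> nat)) set \<Rightarrow> bool" where
  "lightface_Sigma01 n A P \<longleftrightarrow>
     (\<exists>R. recursive_in (word_code n ` A) 2 R \<and>
        P = {(m, \<alpha>). \<alpha> \<in> topspace (omega_words n) \<and> (\<exists>k. R [m, word_code n (restr \<alpha> k)] = 0)})"

definition lightface_Pi02 :: "nat \<Rightarrow> nat list set \<Rightarrow> (nat \<Rightarrow> nat) set \<Rightarrow> bool" where
  "lightface_Pi02 n A X \<longleftrightarrow>
     (\<exists>P. lightface_Sigma01 n A P \<and> X = {\<alpha> \<in> topspace (omega_words n). \<forall>m. (m, \<alpha>) \<in> P})"

end

theory Submission
  imports Defs "HOL-Library.Omega_Words_Fun"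
begin

text \<open>
  An infinite word \<open>\<alpha>\<close> belongs to the power of \<open>A\<close> iff it can be cut at positions
  \<open>0 = p\<^sub>0 < p\<^sub>1 < \<dots>\<close> such that every factor lies in \<open>A\<close>, that is, iff the graph \<open>steps A \<alpha>\<close> on the
  natural numbers has an infinite path from 0.

  Antichains.  The antichain consisting of the empty word has empty power; let \<open>A\<close> be any other antichain.
  Two words of \<open>A\<close> that are prefixes of a common word coincide, so a word has at most one parse: every
  vertex of the graph has at most one successor.  There are two consequences.

  First, partial parses of increasing length extend each other.  Hence \<open>\<alpha>\<close> lies in the power iff for
  every \<open>m\<close> some finite prefix of \<open>\<alpha>\<close> begins with \<open>m\<close> words of \<open>A\<close>; the latter is decidable relative to
  \<open>A\<close> by stripping words of \<open>A\<close> off the prefix, and the power is \<open>\<Pi>\<^sup>0\<^sub>2(A)\<close>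
  (\<open>lightface_Pi02_omega_power\<close>).

  Second, if \<open>w\<close> is a product of words of \<open>A\<close> and \<open>w \<frown> \<gamma>\<close> is in the power, then so is \<open>\<gamma>\<close>
  (\<open>omega_power_conc_cancel\<close>).  A nonempty open power contains all infinite words that begin with some
  such \<open>w\<close>, hence all infinite words.  If the power is not closed, pick \<open>\<gamma>\<close> outside it but in its
  closure; the translates \<open>w \<frown> \<gamma>\<close> also lie outside it, and they accumulate everywhere on it.  A category
  argument, in which the point to be found is built directly as an infinite concatenation, then shows
  that the power is not \<open>F\<^sub>\<sigma>\<close> (\<open>not_fsigma_in_omega_power\<close>).

  Finite antichains only.  Let \<open>G\<close> be the set of infinite words with arbitrarily long prefixes that are
  products of words of \<open>A\<close>; it is a \<open>G\<^sub>\<delta>\<close> set containing the power.  By Koenig's lemma, an element of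
  \<open>G\<close> is in the power unless some position of it starts infinitely many words of \<open>A\<close>, that is, unless a
  tail of it is a limit of words of \<open>A\<close>.  An accumulation point of such limits would be the spine of a
  comb, and the teeth of a comb are an infinite antichain in \<open>A\<close>; so the limits are isolated from each
  other, hence countable.  The power thus arises from \<open>G\<close> by removing countably many points
  (\<open>finite_antichains_imp_gdelta\<close>).

  The two examples that are not \<open>F\<^sub>\<sigma>\<close> are \<open>{1\<^sup>k0}\<close>, whose power consists of the words over 0 and 1 with
  infinitely many zeros, and the chain \<open>{01\<^sup>k}\<close>, whose power consists of those that moreover begin with
  a zero; the category argument applies with \<open>\<gamma>\<close> equal to \<open>111\<dots>\<close> and \<open>0111\<dots>\<close> respectively.
\<close>

section \<open>Infinite concatenations as paths through cut positions\<close>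

lemma restr_eq_subsequence: "restr \<alpha> k = subsequence \<alpha> 0 k"
  by (simp add: restr_def subsequence_def)

lemma subsequence_join: "i \<le> j \<Longrightarrow> j \<le> k \<Longrightarrow> subsequence \<alpha> i j @ subsequence \<alpha> j k = subsequence \<alpha> i k"
  unfolding subsequence_def by (metis le_Suc_ex map_append upt_add_eq_append)

definition steps :: "nat list set \<Rightarrow> (nat \<Rightarrow> nat) \<Rightarrow> (nat \<times> nat) set" where
  "steps A \<alpha> = {(p, q). p < q \<and> subsequence \<alpha> p q \<in> A}"

lemma steps_path_ge:
  assumes "\<And>i. (p i, p (Suc i)) \<in> steps A \<alpha>"
  shows "i \<le> p i"
proof (induction i)
  case (Suc i)
  then show ?case
    using assms[of i] by (simp add: steps_def)
qed simp

lemma omega_powerI: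
  assumes p0: "p 0 = 0" and p: "\<And>i. (p i, p (Suc i)) \<in> steps A \<alpha>"
  shows "\<alpha> \<in> omega_power A"
proof -
  define a where "a i = subsequence \<alpha> (p i) (p (Suc i))" for i
  have less: "p i < p (Suc i)" for i
    using p by (simp add: steps_def)
  have con: "concat (map a [0..<i]) = subsequence \<alpha> 0 (p i)" for i
  proof (induction i)
    case (Suc i)
    then show ?case
      using less[of i] by (simp add: a_def subsequence_join)
  qed (simp add: p0)
  have "i \<le> p i" for i
    using p by (rule steps_path_ge)
  then have "is_inf_concat a \<alpha>"
    unfolding is_inf_concat_def con by (auto simp: restr_eq_subsequence)
  moreover have "a i \<in> A" for i
    using p by (simp add: a_def steps_def)
  ultimately show ?thesis
    unfolding omega_power_def by blast
qed

text \<open>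
  The representing sequence may contain empty words, while the steps of the graph are strict.  So the
  path runs through the set of cut positions rather than through their enumeration by word indices.
\<close>

lemma omega_powerE:
  assumes "\<alpha> \<in> omega_power A"
  obtains p where "p 0 = 0" "\<And>i. (p i, p (Suc i)) \<in> steps A \<alpha>"
proof -
  obtain a where aA: "\<And>i. a i \<in> A" and a: "is_inf_concat a \<alpha>"
    using assms unfolding omega_power_def by blast
  define q where "q i = length (concat (map a [0..<i]))" for i
  have pre: "concat (map a [0..<i]) = subsequence \<alpha> 0 (q i)" for i
    using a unfolding is_inf_concat_def Let_def restr_eq_subsequence q_def by blast
  have unb: "\<exists>i. k \<le> q i" for k
    using a unfolding is_inf_concat_def q_def by blast
  have qSuc: "q (Suc i) = q i + length (a i)" for i
    by (simp add: q_def)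
  then have mono: "mono q"
    by (simp add: mono_iff_le_Suc)
  have word: "subsequence \<alpha> (q i) (q (Suc i)) = a i" for i
  proof -
    have "subsequence \<alpha> 0 (q i) @ a i = subsequence \<alpha> 0 (q i) @ subsequence \<alpha> (q i) (q (Suc i))"
      using pre[of i] pre[of "Suc i"] qSuc[of i] by (simp add: subsequence_join)
    then show ?thesis
      by simp
  qed
  \<comment> \<open>Empty words make cut positions repeat, so the step leaving a position uses the last index.\<close>
  have next_step: "\<exists>y. y \<in> range q \<and> (x, y) \<in> steps A \<alpha>" if x: "x \<in> range q" for x
  proof -
    obtain i where i: "x = q i"
      using x by blast
    have ex: "\<exists>j. x < q j"
      using unb[of "Suc x"] by (simp add: Suc_le_eq)
    define j where "j = (LEAST j. x < q j)"
    have j: "x < q j"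
      unfolding j_def using ex by (rule LeastI_ex)
    then have "i < j"
      using monoD[OF mono, of j i] i by (meson leD not_le_imp_less)
    then obtain j' where j': "j = Suc j'" "i \<le> j'"
      by (cases j) auto
    have "\<not> x < q j'"
      using not_less_Least[of j' "\<lambda>j. x < q j"] j'(1) unfolding j_def by simp
    then have "q j' = x"
      using monoD[OF mono j'(2)] i by simp
    then have "(x, q j) \<in> steps A \<alpha>"
      using word[of j'] aA[of j'] j j'(1) by (simp add: steps_def)
    then show ?thesis
      by blast
  qed
  have "\<exists>p. \<forall>i. (p i \<in> range q \<and> (i = 0 \<longrightarrow> p i = 0)) \<and> (p i, p (Suc i)) \<in> steps A \<alpha>"
  proof (rule dependent_nat_choice)
    have "q 0 = 0"
      by (simp add: q_def)
    then show "\<exists>x. x \<in> range q \<and> (0 = 0 \<longrightarrow> x = 0)"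
      by (metis rangeI)
  qed (use next_step in auto)
  then show ?thesis
    using that by metis
qed

text \<open>A path of the transitive closure is refined step by step: the positions from which such a path
  starts are closed under a suitable single step.\<close>

lemma omega_powerI_trancl:
  assumes p0: "p 0 = 0" and p: "\<And>i. (p i, p (Suc i)) \<in> (steps A \<alpha>)\<^sup>+"
  shows "\<alpha> \<in> omega_power A"
proof -
  let ?E = "steps A \<alpha>"
  define G where "G = {x. \<exists>p. p 0 = x \<and> (\<forall>i. (p i, p (Suc i)) \<in> ?E\<^sup>+)}"
  have next_step: "\<exists>y. y \<in> G \<and> (x, y) \<in> ?E" if "x \<in> G" for x
  proof -
    have "\<exists>r. r 0 = x \<and> (\<forall>i. (r i, r (Suc i)) \<in> ?E\<^sup>+)"
      using that by (simp add: G_def)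
    then obtain r where r: "r 0 = x" "\<And>i. (r i, r (Suc i)) \<in> ?E\<^sup>+"
      by metis
    obtain z where z: "(x, z) \<in> ?E" "(z, r 1) \<in> ?E\<^sup>*"
      using r(2)[of 0] r(1) tranclD[of x "r 1" ?E] by auto
    have "(z, r 2) \<in> ?E\<^sup>+"
      using z(2) r(2)[of 1] by (simp add: numeral_2_eq_2)
    then have "\<forall>i. (case_nat z (\<lambda>i. r (i + 2)) i, case_nat z (\<lambda>i. r (i + 2)) (Suc i)) \<in> ?E\<^sup>+"
      using r(2) by (auto simp: numeral_2_eq_2 split: nat.split)
    then have "z \<in> G"
      unfolding G_def by (intro CollectI exI[of _ "case_nat z (\<lambda>i. r (i + 2))"]) simp
    with z(1) show ?thesis
      by blast
  qed
  have "\<exists>p. \<forall>i. (p i \<in> G \<and> (i = 0 \<longrightarrow> p i = 0)) \<and> (p i, p (Suc i)) \<in> ?E"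
  proof (rule dependent_nat_choice)
    have "0 \<in> G"
      unfolding G_def using p0 p by blast
    then show "\<exists>x. x \<in> G \<and> (0 = 0 \<longrightarrow> x = 0)"
      by blast
  qed (use next_step in auto)
  then show ?thesis
    using omega_powerI by metis
qed

section \<open>The topology of infinite words\<close>

lemma topspace_omega_words: "\<alpha> \<in> topspace (omega_words n) \<longleftrightarrow> (\<forall>i. \<alpha> i < n)"
  by (auto simp: omega_words_def PiE_iff)

lemma initial_segments_eq_iff: "subsequence \<alpha> 0 k = subsequence \<beta> 0 k \<longleftrightarrow> (\<forall>i<k. \<alpha> i = \<beta> i)"
  by (auto simp: subsequence_def)

text \<open>
  The cylinders given by initial segments form a base, because a basic open set of the product topology
  restricts finitely many coordinates only.
\<close>

lemma openin_omega_words: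
  "openin (omega_words n) U \<longleftrightarrow> U \<subseteq> topspace (omega_words n) \<and>
    (\<forall>\<alpha>\<in>U. \<exists>k. \<forall>\<beta>\<in>topspace (omega_words n). subsequence \<alpha> 0 k = subsequence \<beta> 0 k \<longrightarrow> \<beta> \<in> U)"
    (is "?L \<longleftrightarrow> ?R")
proof
  assume L: ?L
  have "\<exists>k. \<forall>\<beta>\<in>topspace (omega_words n). subsequence \<alpha> 0 k = subsequence \<beta> 0 k \<longrightarrow> \<beta> \<in> U" if \<alpha>: "\<alpha> \<in> U" for \<alpha>
  proof -
    obtain V where V: "finite {i. V i \<noteq> {..<n}}" "\<alpha> \<in> Pi\<^sub>E UNIV V" "Pi\<^sub>E UNIV V \<subseteq> U"
      using L \<alpha> unfolding omega_words_def openin_product_topology_alt by auto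
    obtain k where k: "\<forall>i \<in> {i. V i \<noteq> {..<n}}. i < k"
      using V(1) finite_nat_set_iff_bounded by blast
    have "\<beta> \<in> U" if "\<beta> \<in> topspace (omega_words n)" "subsequence \<alpha> 0 k = subsequence \<beta> 0 k" for \<beta>
    proof -
      have "\<beta> i \<in> V i" for i
      proof (cases "i < k")
        case True
        then show ?thesis
          using that(2) V(2) unfolding initial_segments_eq_iff PiE_iff by (metis UNIV_I)
      next
        case False
        then have "V i = {..<n}"
          using k by blast
        then show ?thesis
          using that(1) by (simp add: topspace_omega_words)
      qed
      then show ?thesis
        using V(3) by (auto simp: PiE_iff)
    qed
    then show ?thesis
      by blast
  qed
  then show ?R
    using L openin_subset by blast
next
  assume R: ?R
  have "\<exists>V. finite {i \<in> UNIV. V i \<noteq> topspace (discrete_topology {..<n})} \<and>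
      (\<forall>i \<in> UNIV. openin (discrete_topology {..<n}) (V i)) \<and> \<alpha> \<in> Pi\<^sub>E UNIV V \<and> Pi\<^sub>E UNIV V \<subseteq> U"
    if \<alpha>: "\<alpha> \<in> U" for \<alpha>
  proof -
    obtain k where k: "\<forall>\<beta>\<in>topspace (omega_words n). subsequence \<alpha> 0 k = subsequence \<beta> 0 k \<longrightarrow> \<beta> \<in> U"
      using R \<alpha> by blast
    define V where "V i = (if i < k then {\<alpha> i} else {..<n})" for i
    have lt: "\<alpha> i < n" for i
      using R \<alpha> topspace_omega_words by blast
    have "{i. V i \<noteq> {..<n}} \<subseteq> {..<k}"
      by (auto simp: V_def)
    then have "finite {i. V i \<noteq> {..<n}}"
      using finite_subset by blast
    moreover have "V i \<subseteq> {..<n}" for i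
      using lt by (simp add: V_def)
    moreover have "\<alpha> \<in> Pi\<^sub>E UNIV V"
      using lt by (auto simp: V_def PiE_iff)
    moreover have "\<beta> \<in> U" if "\<beta> \<in> Pi\<^sub>E UNIV V" for \<beta>
    proof -
      have \<beta>: "\<beta> i \<in> V i" for i
        using that by (simp add: PiE_iff)
      have "\<beta> i < n" for i
        using \<beta>[of i] lt[of i] by (auto simp: V_def split: if_splits)
      moreover have "\<forall>i<k. \<alpha> i = \<beta> i"
        using \<beta> by (metis V_def singletonD)
      ultimately show ?thesis
        using k by (simp add: initial_segments_eq_iff topspace_omega_words)
    qed
    ultimately show ?thesis
      by (intro exI[of _ V]) auto
  qed
  then show ?L
    unfolding omega_words_def openin_product_topology_alt by blast
qed

lemma closedin_omega_words_separated:
  assumes "closedin (omega_words n) F" "\<alpha> \<in> topspace (omega_words n)" "\<alpha> \<notin> F"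
  obtains k where "\<And>\<beta>. \<beta> \<in> topspace (omega_words n) \<Longrightarrow> subsequence \<alpha> 0 k = subsequence \<beta> 0 k \<Longrightarrow> \<beta> \<notin> F"
  using assms unfolding closedin_def openin_omega_words by blast

lemma closedin_omega_words_singleton:
  "\<alpha> \<in> topspace (omega_words n) \<Longrightarrow> closedin (omega_words n) {\<alpha>}"
  unfolding omega_words_def
  by (rule closedin_Hausdorff_singleton) (auto simp: Hausdorff_space_product_topology)

lemma omega_power_subset_topspace:
  assumes "A \<subseteq> lists {..<n}"
  shows "omega_power A \<subseteq> topspace (omega_words n)"
proof
  fix \<alpha> assume "\<alpha> \<in> omega_power A"
  then obtain a where a: "\<And>i. a i \<in> A" "is_inf_concat a \<alpha>"
    unfolding omega_power_def by blast
  have "\<alpha> j < n" for j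
  proof -
    obtain i where i: "Suc j \<le> length (concat (map a [0..<i]))"
      using a(2) unfolding is_inf_concat_def by blast
    let ?w = "concat (map a [0..<i])"
    have w: "?w = restr \<alpha> (length ?w)"
      using a(2) unfolding is_inf_concat_def Let_def by blast
    have "restr \<alpha> (length ?w) ! j = \<alpha> j"
      using i by (simp add: restr_def del: length_concat)
    then have "?w ! j = \<alpha> j"
      unfolding w[symmetric] .
    moreover have "set ?w \<subseteq> {..<n}"
      using a(1) assms by (auto simp: subset_iff)
    ultimately show ?thesis
      using i nth_mem[of j ?w] by (simp add: Suc_le_eq subset_iff del: set_concat length_concat)
  qed
  then show "\<alpha> \<in> topspace (omega_words n)"
    by (simp add: topspace_omega_words)
qed

lemma omega_power_conc:
  assumes "u \<in> A" "\<gamma> \<in> omega_power A"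
  shows "u \<frown> \<gamma> \<in> omega_power A"
proof -
  obtain a where a: "\<And>i. a i \<in> A" "is_inf_concat a \<gamma>"
    using assms(2) unfolding omega_power_def by blast
  let ?b = "case_nat u a"
  have con: "concat (map ?b [0..<Suc i]) = u @ concat (map a [0..<i])" for i
    by (simp add: map_upt_Suc del: upt_Suc)
  have pre: "concat (map a [0..<i]) = subsequence \<gamma> 0 (length (concat (map a [0..<i])))" for i
    using a(2) unfolding is_inf_concat_def Let_def restr_eq_subsequence by blast
  have "concat (map ?b [0..<i]) = subsequence (u \<frown> \<gamma>) 0 (length (concat (map ?b [0..<i])))" for i
  proof (cases i)
    case (Suc j)
    let ?c = "concat (map a [0..<j])"
    have "subsequence (u \<frown> \<gamma>) 0 (length (u @ ?c)) = u @ subsequence \<gamma> 0 (length ?c)"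
      by simp
    then show ?thesis
      unfolding Suc con using pre[of j] by metis
  qed simp
  moreover have "\<exists>i. k \<le> length (concat (map ?b [0..<i]))" for k
  proof -
    obtain i where "k \<le> length (concat (map a [0..<i]))"
      using a(2) unfolding is_inf_concat_def by blast
    then have "k \<le> length (concat (map ?b [0..<Suc i]))"
      unfolding con by simp
    then show ?thesis
      by blast
  qed
  ultimately have "is_inf_concat ?b (u \<frown> \<gamma>)"
    unfolding is_inf_concat_def Let_def restr_eq_subsequence by blast
  moreover have "?b i \<in> A" for i
    using a(1) assms(1) by (simp split: nat.split)
  ultimately show ?thesis
    unfolding omega_power_def by blast
qed

section \<open>A category argument inside an omega-power\<close>

text \<open>
  The closure has to be reflexive: empty words among \<open>us\<close> do not move the position.
\<close>

lemma rtrancl_steps_conc: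
  assumes "us \<in> lists A"
  shows "(length w, length (w @ concat us)) \<in> (steps A ((w @ concat us) \<frown> \<delta>))\<^sup>*"
  using assms
proof (induction us arbitrary: w)
  case (Cons u us)
  let ?\<beta> = "(w @ concat (u # us)) \<frown> \<delta>"
  have IH: "(length (w @ u), length (w @ concat (u # us))) \<in> (steps A ?\<beta>)\<^sup>*"
    using Cons.IH[of "w @ u"] Cons.prems by simp
  have "subsequence ?\<beta> (length w) (length (w @ u)) = u"
    by (intro nth_equalityI) (auto simp: conc_def nth_append)
  moreover have "u \<in> A"
    using Cons.hyps by simp
  ultimately have "u = [] \<or> (length w, length (w @ u)) \<in> steps A ?\<beta>"
    by (cases u) (auto simp: steps_def)
  then show ?case
  proof
    assume "u = []"
    then show ?case
      using IH by simp
  next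
    assume "(length w, length (w @ u)) \<in> steps A ?\<beta>"
    then show ?case
      using IH by (rule converse_rtrancl_into_rtrancl)
  qed
qed simp

lemma omega_power_prefix_long:
  assumes "\<beta> \<in> omega_power A"
  obtains us where "us \<in> lists A" "k < length (concat us)" "concat us = subsequence \<beta> 0 (length (concat us))"
proof -
  obtain a where a: "\<And>i. a i \<in> A" "is_inf_concat a \<beta>"
    using assms unfolding omega_power_def by blast
  obtain i where long: "Suc k \<le> length (concat (map a [0..<i]))"
    using a(2) unfolding is_inf_concat_def by blast
  have pre: "concat (map a [0..<i]) = subsequence \<beta> 0 (length (concat (map a [0..<i])))"
    using a(2) unfolding is_inf_concat_def Let_def restr_eq_subsequence by blast
  have "map a [0..<i] \<in> lists A"
    using a(1) by auto
  then show ?thesis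
    using that Suc_le_lessD[OF long] pre by blast
qed

text \<open>
  Relative category argument, made explicit.  The translates \<open>w \<frown> \<gamma>\<close> are dense in the closure of
  the power but lie outside the power itself.  If the power is a union of closed sets, a word in the
  generated submonoid can therefore be prolonged so as to avoid the next of them; the limit of these
  prolongations is an infinite concatenation that lies in none of the closed sets.
\<close>

lemma not_fsigma_in_omega_power:
  assumes A: "A \<subseteq> lists {..<n}" and \<gamma>: "\<gamma> \<in> topspace (omega_words n)"
    and outside: "\<And>us. us \<in> lists A \<Longrightarrow> concat us \<frown> \<gamma> \<notin> omega_power A"
    and limit: "\<And>k. \<exists>\<beta> \<in> omega_power A. subsequence \<beta> 0 k = subsequence \<gamma> 0 k"
  shows "\<not> fsigma_in (omega_words n) (omega_power A)"
proof
  let ?X = "topspace (omega_words n)"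
  assume "fsigma_in (omega_words n) (omega_power A)"
  then obtain F :: "nat \<Rightarrow> (nat \<Rightarrow> nat) set" where F: "\<And>i. closedin (omega_words n) (F i)" "\<Union> (range F) = omega_power A"
    unfolding fsigma_in_ascending by metis
  have star: "concat us \<in> lists {..<n}" if "us \<in> lists A" for us
    using that by induction (use A in auto)
  have conc_top: "w \<frown> \<delta> \<in> ?X" if "w \<in> lists {..<n}" "\<delta> \<in> ?X" for w \<delta>
    using that by (auto simp: topspace_omega_words conc_def)
  let ?avoids = "\<lambda>i us. \<forall>\<alpha> \<in> ?X. subsequence \<alpha> 0 (length (concat us)) = concat us \<longrightarrow> \<alpha> \<notin> F i"
  have extend: "\<exists>us'. us' \<in> lists A \<and>
      (\<exists>vs. us' = us @ vs \<and> concat vs \<noteq> [] \<and> ?avoids i us')" if us: "us \<in> lists A" for us i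
  proof -
    let ?w = "concat us"
    have "?w \<frown> \<gamma> \<notin> F i"
      using outside[OF us] F(2) by blast
    \<comment> \<open>A cylinder around \<open>?w \<frown> \<gamma>\<close> misses \<open>F i\<close>; it is then refined to a word of the submonoid.\<close>
    then obtain k where k: "\<And>\<beta>. \<beta> \<in> ?X \<Longrightarrow> subsequence (?w \<frown> \<gamma>) 0 k = subsequence \<beta> 0 k \<Longrightarrow> \<beta> \<notin> F i"
      using closedin_omega_words_separated[OF F(1) conc_top[OF star[OF us] \<gamma>]] by metis
    \<comment> \<open>An element of the power close to \<open>\<gamma>\<close> provides a prolongation of \<open>?w\<close> inside this cylinder.\<close>
    obtain \<beta> where \<beta>: "\<beta> \<in> omega_power A" "subsequence \<beta> 0 k = subsequence \<gamma> 0 k"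
      using limit by blast
    obtain vs where vs: "vs \<in> lists A" "k < length (concat vs)"
        "concat vs = subsequence \<beta> 0 (length (concat vs))"
      using omega_power_prefix_long[OF \<beta>(1)] by metis
    have nth_vs: "concat vs ! j = \<gamma> j" if "j < k" for j
    proof -
      have "concat vs ! j = \<beta> j"
        using that vs(2) by (subst vs(3)) simp
      then show ?thesis
        using \<beta>(2) that by (simp add: initial_segments_eq_iff)
    qed
    have "\<alpha> \<notin> F i" if \<alpha>: "\<alpha> \<in> ?X" "subsequence \<alpha> 0 (length (concat (us @ vs))) = concat (us @ vs)" for \<alpha>
    proof (rule k[OF \<alpha>(1)])
      have nth: "\<alpha> j = (concat us @ concat vs) ! j" if "j < length (concat us @ concat vs)" for j
        using \<alpha>(2) that by (metis add_0 concat_append diff_zero subsequence_nth)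
      have "(?w \<frown> \<gamma>) j = \<alpha> j" if "j < k" for j
        using nth[of j] vs(2) that by (auto simp: conc_def nth_append nth_vs)
      then show "subsequence (?w \<frown> \<gamma>) 0 k = subsequence \<alpha> 0 k"
        by (simp add: initial_segments_eq_iff)
    qed
    moreover have "concat vs \<noteq> []"
      using vs(2) by (metis less_nat_zero_code list.size(3))
    ultimately show ?thesis
      using us vs(1) by (intro exI[of _ "us @ vs"]) auto
  qed
  have "\<exists>U. \<forall>i. (U i \<in> lists A \<and> (i = 0 \<longrightarrow> U i = [])) \<and>
      (\<exists>vs. U (Suc i) = U i @ vs \<and> concat vs \<noteq> [] \<and> ?avoids i (U (Suc i)))"
    by (rule dependent_nat_choice) (use extend in auto)
  then obtain U where U: "\<And>i. U i \<in> lists A" "U 0 = []"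
      and U_step: "\<And>i. \<exists>vs. U (Suc i) = U i @ vs \<and> concat vs \<noteq> [] \<and> ?avoids i (U (Suc i))"
    by metis
  obtain V where V: "\<And>i. U (Suc i) = U i @ V i" "\<And>i. concat (V i) \<noteq> []"
      "\<And>i. ?avoids i (U (Suc i))"
    using U_step by metis
  define w where "w i = concat (U i)" for i
  have w_Suc: "w (Suc i) = w i @ concat (V i)" for i
    by (simp add: w_def V(1))
  have w_len: "length (w i) < length (w (Suc i))" for i
    using V(2) by (simp add: w_Suc)
  have w_ge: "i \<le> length (w i)" for i
  proof (induction i)
    case (Suc i)
    then show ?case
      using w_len[of i] by simp
  qed simp
  have w_pre: "\<exists>v. w j = w i @ v" if "i \<le> j" for i j
    using that by (induction rule: dec_induct) (auto simp: w_Suc)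
  define \<alpha> where "\<alpha> i = w (Suc i) ! i" for i
  have \<alpha>_nth: "\<alpha> j = w i ! j" if "j < length (w i)" for i j
  proof (cases "i \<le> Suc j")
    case True
    then show ?thesis
      using w_pre[OF True] that by (auto simp: \<alpha>_def nth_append)
  next
    case False
    then have "Suc j \<le> i"
      by simp
    then show ?thesis
      using w_pre[of "Suc j" i] w_ge[of "Suc j"] by (auto simp: \<alpha>_def nth_append)
  qed
  have \<alpha>_w: "subsequence \<alpha> 0 (length (w i)) = w i" for i
    by (intro nth_equalityI) (auto simp: \<alpha>_nth)
  have \<alpha>_conc: "\<alpha> = w i \<frown> suffix (length (w i)) \<alpha>" for i
    by (metis \<alpha>_w prefix_suffix)
  have "\<alpha> i < n" for i
  proof -
    have "w (Suc i) ! i \<in> set (w (Suc i))"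
      using w_ge[of "Suc i"] by (intro nth_mem) simp
    moreover have "w (Suc i) \<in> lists {..<n}"
      unfolding w_def by (rule star[OF U(1)])
    ultimately show ?thesis
      unfolding \<alpha>_def by auto
  qed
  then have top: "\<alpha> \<in> ?X"
    by (simp add: topspace_omega_words)
  have "(length (w i), length (w (Suc i))) \<in> (steps A \<alpha>)\<^sup>*" for i
  proof -
    have "V i \<in> lists A"
      using U(1)[of "Suc i"] by (simp add: V(1))
    then have "(length (w i), length (w i @ concat (V i))) \<in>
        (steps A ((w i @ concat (V i)) \<frown> suffix (length (w (Suc i))) \<alpha>))\<^sup>*"
      by (rule rtrancl_steps_conc)
    then show ?thesis
      using \<alpha>_conc[of "Suc i"] by (simp add: w_Suc)
  qed
  then have "(length (w i), length (w (Suc i))) \<in> (steps A \<alpha>)\<^sup>+" for i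
    using w_len[of i] by (metis less_irrefl rtranclD)
  then have "\<alpha> \<in> omega_power A"
    by (intro omega_powerI_trancl[of "\<lambda>i. length (w i)"]) (auto simp: w_def U(2))
  then obtain i where "\<alpha> \<in> F i"
    using F(2) by blast
  moreover have "\<alpha> \<notin> F i"
    using V(3)[of i] top \<alpha>_w[of "Suc i"] by (simp add: w_def)
  ultimately show False
    by blast
qed

section \<open>Unique parsing\<close>

lemma word_antichainD:
  assumes "word_antichain A" "u \<in> A" "v \<in> A" "Sublist.prefix u v \<or> Sublist.prefix v u"
  shows "u = v"
  using assms unfolding word_antichain_def pairwise_def parallel_def by blast

text \<open>
  Of two words of an antichain that are prefixes of the same word, one is a prefix of the other, so they
  coincide; the first factors of two parses therefore agree and can be cancelled.
\<close>

lemma antichain_parse_unique: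
  assumes A: "word_antichain A"
  shows "us \<in> lists A \<Longrightarrow> vs \<in> lists A \<Longrightarrow> length us \<le> length vs \<Longrightarrow>
    Sublist.prefix (concat us) w \<Longrightarrow> Sublist.prefix (concat vs) w \<Longrightarrow> us = take (length us) vs"
proof (induction us arbitrary: vs w)
  case (Cons u us)
  then obtain v vs' where vs: "vs = v # vs'"
    by (cases vs) auto
  have "Sublist.prefix u w" "Sublist.prefix v w"
    using Cons.prems(4,5) append_prefixD by (auto simp: vs)
  then have "u = v"
    using word_antichainD[OF A, of u v] Cons.prems(1,2) prefix_same_cases[of u w v] by (simp add: vs)
  moreover obtain w' where w': "w = u @ w'"
    using \<open>Sublist.prefix u w\<close> by (auto elim: prefixE)
  ultimately show ?case
    using Cons.IH[of vs' w'] Cons.prems by (auto simp: vs)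
qed simp

text \<open>
  A decomposition of \<open>u \<frown> \<delta>\<close> with \<open>u\<close> in \<open>A\<close> begins with a word comparable to \<open>u\<close>, hence with \<open>u\<close> itself; the
  remaining factors decompose \<open>\<delta>\<close>.
\<close>

lemma omega_power_conc_cancel:
  assumes A: "word_antichain A" "[] \<notin> A" and us: "us \<in> lists A" and "concat us \<frown> \<gamma> \<in> omega_power A"
  shows "\<gamma> \<in> omega_power A"
  using us assms(4)
proof (induction us)
  case (Cons u us)
  let ?\<alpha> = "u \<frown> (concat us \<frown> \<gamma>)"
  have "?\<alpha> \<in> omega_power A"
    using Cons.prems by simp
  then obtain p where p: "p 0 = 0" "\<And>i. (p i, p (Suc i)) \<in> steps A ?\<alpha>"
    by (rule omega_powerE) blast
  have "subsequence ?\<alpha> 0 (p 1) \<in> A"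
    using p(2)[of 0] p(1) by (simp add: steps_def)
  moreover have "Sublist.prefix u (subsequence ?\<alpha> 0 (p 1)) \<or> Sublist.prefix (subsequence ?\<alpha> 0 (p 1)) u"
    by (cases "length u \<le> p 1") (simp_all add: take_is_prefix del: conc_conc)
  moreover have "u \<in> A"
    using Cons.hyps by simp
  ultimately have "subsequence ?\<alpha> 0 (p 1) = u"
    using word_antichainD[OF A(1)] by blast
  then have p1: "p 1 = length u"
    by (metis diff_zero subsequence_length)
  have ge: "length u \<le> p (Suc i)" for i
  proof (induction i)
    case (Suc i)
    then show ?case
      using p(2)[of "Suc i"] by (simp add: steps_def)
  qed (use p1 in simp)
  have "concat us \<frown> \<gamma> \<in> omega_power A"
  proof (rule omega_powerI[where p = "\<lambda>i. p (Suc i) - length u"])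
    fix i
    have "subsequence (concat us \<frown> \<gamma>) (p (Suc i) - length u) (p (Suc (Suc i)) - length u) =
        subsequence (suffix (length u) ?\<alpha>) (p (Suc i) - length u) (p (Suc (Suc i)) - length u)"
      by (simp del: conc_conc)
    also have "\<dots> = subsequence ?\<alpha> (p (Suc i)) (p (Suc (Suc i)))"
      using ge[of i] ge[of "Suc i"] by (simp only: subsequence_shift) simp
    finally show "(p (Suc i) - length u, p (Suc (Suc i)) - length u) \<in> steps A (concat us \<frown> \<gamma>)"
      using p(2)[of "Suc i"] ge[of i] by (auto simp: steps_def)
  qed (use p1 in simp)
  then show ?case
    by (rule Cons.IH)
qed simp

text \<open>
  The quantifier exchange: finite parses of every length give an infinite one, because by uniqueness
  the parse into \<open>m\<close> words is an initial part of the parse into \<open>m + 1\<close> words.  It is the form in which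
  the power becomes \<open>\<Pi>\<^sup>0\<^sub>2\<close>.
\<close>

lemma omega_power_iff_prefixes:
  assumes A: "word_antichain A" "[] \<notin> A"
  shows "\<alpha> \<in> omega_power A \<longleftrightarrow> (\<forall>m. \<exists>k us. length us = m \<and> us \<in> lists A \<and> Sublist.prefix (concat us) (restr \<alpha> k))"
    (is "_ \<longleftrightarrow> ?R")
proof
  assume "\<alpha> \<in> omega_power A"
  then obtain a where a: "\<And>i. a i \<in> A" "is_inf_concat a \<alpha>"
    unfolding omega_power_def by blast
  show ?R
  proof
    fix m
    have "concat (map a [0..<m]) = restr \<alpha> (length (concat (map a [0..<m])))"
      using a(2) unfolding is_inf_concat_def Let_def by blast
    then have "Sublist.prefix (concat (map a [0..<m])) (restr \<alpha> (length (concat (map a [0..<m]))))"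
      by (metis prefix_order.refl)
    moreover have "map a [0..<m] \<in> lists A"
      using a(1) by auto
    ultimately show "\<exists>k us. length us = m \<and> us \<in> lists A \<and> Sublist.prefix (concat us) (restr \<alpha> k)"
      by (metis diff_zero length_map length_upt)
  qed
next
  assume ?R
  then have "\<forall>m. \<exists>us k. length us = m \<and> us \<in> lists A \<and> Sublist.prefix (concat us) (restr \<alpha> k)"
    by blast
  then obtain V where "\<forall>m. \<exists>k. length (V m) = m \<and> V m \<in> lists A \<and> Sublist.prefix (concat (V m)) (restr \<alpha> k)"
    by metis
  then obtain K where V: "\<And>m. length (V m) = m" "\<And>m. V m \<in> lists A"
      "\<And>m. Sublist.prefix (concat (V m)) (restr \<alpha> (K m))"
    by metis
  have restr_mono: "Sublist.prefix (restr \<alpha> k) (restr \<alpha> l)" if "k \<le> l" for k l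
    using that by (metis le_add_diff_inverse map_append prefixI restr_def upt_add_eq_append le0)
  have V_take: "V m = take m (V (Suc m))" for m
    using antichain_parse_unique[OF A(1) V(2) V(2), of m "Suc m" "restr \<alpha> (max (K m) (K (Suc m)))"]
      V(1,3) restr_mono by (metis le_SucI max.cobounded1 max.cobounded2 order_refl prefix_order.trans)
  define a where "a i = V (Suc i) ! i" for i
  have map_a: "map a [0..<m] = V m" for m
  proof (induction m)
    case (Suc m)
    have "V (Suc m) = take m (V (Suc m)) @ [V (Suc m) ! m]"
      using V(1)[of "Suc m"] by (metis lessI take_Suc_conv_app_nth take_all_iff order_refl)
    then show ?case
      using Suc V_take[of m] by (simp add: a_def)
  qed (use V(1)[of 0] in simp)
  have "concat (V m) = restr \<alpha> (length (concat (V m)))" for m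
  proof -
    obtain v where v: "restr \<alpha> (K m) = concat (V m) @ v"
      using V(3) by (auto elim: prefixE)
    then have "concat (V m) = take (length (concat (V m))) (restr \<alpha> (K m))"
      by simp
    also have "\<dots> = restr \<alpha> (length (concat (V m)))"
      using arg_cong[OF v, of length] by (simp add: restr_def take_map del: length_concat)
    finally show ?thesis .
  qed
  moreover have "length us \<le> length (concat us)" if "us \<in> lists A" for us
    using that
  proof induction
    case (Cons u us)
    then show ?case
      using A(2) by (cases u) auto
  qed simp
  then have "m \<le> length (concat (V m))" for m
    using V(1,2) by metis
  ultimately have "is_inf_concat a \<alpha>"
    unfolding is_inf_concat_def map_a Let_def by blast
  moreover have "a i \<in> A" for i
    using V(1)[of "Suc i"] V(2)[of "Suc i"] unfolding a_def by (auto simp: in_lists_conv_set)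
  ultimately show "\<alpha> \<in> omega_power A"
    unfolding omega_power_def by blast
qed

section \<open>Closed and open powers of antichains\<close>

lemma closedin_omega_words_limit:
  assumes "X \<subseteq> topspace (omega_words n)" "\<not> closedin (omega_words n) X"
  obtains \<gamma> where "\<gamma> \<in> topspace (omega_words n)" "\<gamma> \<notin> X"
    "\<And>k. \<exists>\<beta> \<in> X. subsequence \<beta> 0 k = subsequence \<gamma> 0 k"
proof -
  have "\<not> openin (omega_words n) (topspace (omega_words n) - X)"
    using assms by (simp add: closedin_def)
  then obtain \<gamma> where \<gamma>: "\<gamma> \<in> topspace (omega_words n) - X"
      "\<forall>k. \<exists>\<beta>. \<beta> \<in> topspace (omega_words n) \<and> subsequence \<gamma> 0 k = subsequence \<beta> 0 k \<and> \<beta> \<notin> topspace (omega_words n) - X"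
    unfolding openin_omega_words by (meson Diff_subset)
  have "\<exists>\<beta> \<in> X. subsequence \<beta> 0 k = subsequence \<gamma> 0 k" for k
    using \<gamma>(2)[rule_format, of k] by auto
  then show ?thesis
    using that \<gamma>(1) by blast
qed

lemma antichain_not_closed_imp_not_fsigma:
  assumes A: "A \<subseteq> lists {..<n}" "word_antichain A" "[] \<notin> A"
    and nc: "\<not> closedin (omega_words n) (omega_power A)"
  shows "\<not> fsigma_in (omega_words n) (omega_power A)"
proof -
  obtain \<gamma> where \<gamma>: "\<gamma> \<in> topspace (omega_words n)" "\<gamma> \<notin> omega_power A"
    "\<And>k. \<exists>\<beta> \<in> omega_power A. subsequence \<beta> 0 k = subsequence \<gamma> 0 k"
    using closedin_omega_words_limit[OF omega_power_subset_topspace[OF A(1)] nc] by metis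
  show ?thesis
    using omega_power_conc_cancel[OF A(2,3)] \<gamma> by (intro not_fsigma_in_omega_power[OF A(1) \<gamma>(1)]) blast+
qed

text \<open>
  The power contains a whole cylinder, which may be taken around a product of words of \<open>A\<close>; cancelling
  that product maps the cylinder onto the entire space.
\<close>

lemma antichain_open_imp_all:
  assumes A: "A \<subseteq> lists {..<n}" "word_antichain A" "[] \<notin> A"
    and op: "openin (omega_words n) (omega_power A)" and ne: "omega_power A \<noteq> {}"
  shows "omega_power A = topspace (omega_words n)"
proof
  let ?X = "topspace (omega_words n)"
  show "omega_power A \<subseteq> ?X"
    by (rule omega_power_subset_topspace[OF A(1)])
  obtain \<alpha> where \<alpha>: "\<alpha> \<in> omega_power A"
    using ne by blast
  then obtain k where k: "\<forall>\<beta>\<in>?X. subsequence \<alpha> 0 k = subsequence \<beta> 0 k \<longrightarrow> \<beta> \<in> omega_power A"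
    using op unfolding openin_omega_words by metis
  obtain us where us: "us \<in> lists A" "k < length (concat us)" "concat us = subsequence \<alpha> 0 (length (concat us))"
    using omega_power_prefix_long[OF \<alpha>] by metis
  have nth: "concat us ! i = \<alpha> i" if "i < length (concat us)" for i
    by (subst us(3)) (use that in \<open>simp del: length_concat\<close>)
  show "?X \<subseteq> omega_power A"
  proof
    fix \<gamma> assume \<gamma>: "\<gamma> \<in> ?X"
    have "\<alpha> \<in> ?X"
      using \<alpha> omega_power_subset_topspace[OF A(1)] by blast
    then have "concat us \<frown> \<gamma> \<in> ?X"
      using \<gamma> nth unfolding topspace_omega_words conc_def by presburger
    moreover have "subsequence \<alpha> 0 k = subsequence (concat us \<frown> \<gamma>) 0 k"
      unfolding initial_segments_eq_iff using us(2) nth by (simp add: conc_def del: length_concat)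
    ultimately have "concat us \<frown> \<gamma> \<in> omega_power A"
      using k by blast
    then show "\<gamma> \<in> omega_power A"
      using omega_power_conc_cancel[OF A(2,3) us(1)] by blast
  qed
qed

lemma omega_power_of_Nil: "A \<subseteq> {[]} \<Longrightarrow> omega_power A = {}"
proof (rule ccontr)
  assume "A \<subseteq> {[]}" "omega_power A \<noteq> {}"
  then obtain \<alpha> where "\<alpha> \<in> omega_power A"
    by blast
  then obtain p where p: "p 0 = 0" "\<And>i. (p i, p (Suc i)) \<in> steps A \<alpha>"
    by (rule omega_powerE) blast
  then show False
    using p(2)[of 0] \<open>A \<subseteq> {[]}\<close> by (auto simp: steps_def)
qed

section \<open>Recursive functions relative to an oracle\<close>

text \<open>
  A function on lists matters only on arguments of length \<open>k\<close>.  Closing under agreement on these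
  arguments allows recursive functions to be written as ordinary terms such as \<open>\<lambda>xs. f xs + g xs\<close>,
  without tracking their values on lists of other lengths.
\<close>

definition rec_fn :: "nat set \<Rightarrow> nat \<Rightarrow> (nat list \<Rightarrow> nat) \<Rightarrow> bool" where
  "rec_fn Z k f \<longleftrightarrow> (\<exists>g. recursive_in Z k g \<and> (\<forall>xs. length xs = k \<longrightarrow> g xs = f xs))"

lemma rec_fnI: "recursive_in Z k f \<Longrightarrow> rec_fn Z k f"
  unfolding rec_fn_def by blast

lemma rec_fn_cong: "rec_fn Z k f \<Longrightarrow> (\<And>xs. length xs = k \<Longrightarrow> f xs = g xs) \<Longrightarrow> rec_fn Z k g"
  unfolding rec_fn_def by auto

lemma rec_fn_comp:
  assumes f: "rec_fn Z (length gs) f" and gs: "\<forall>g \<in> set gs. rec_fn Z k g"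
  shows "rec_fn Z k (\<lambda>xs. f (map (\<lambda>g. g xs) gs))"
proof -
  obtain f' where f': "recursive_in Z (length gs) f'" "\<And>xs. length xs = length gs \<Longrightarrow> f' xs = f xs"
    using f unfolding rec_fn_def by blast
  obtain c where c: "\<And>g. g \<in> set gs \<Longrightarrow> recursive_in Z k (c g)"
      "\<And>g xs. g \<in> set gs \<Longrightarrow> length xs = k \<Longrightarrow> c g xs = g xs"
    using gs unfolding rec_fn_def by metis
  have "recursive_in Z k (\<lambda>xs. f' (map (\<lambda>g. g xs) (map c gs)))"
    using f' c by (intro recursive_in.comp) auto
  moreover have "f' (map (\<lambda>g. g xs) (map c gs)) = f (map (\<lambda>g. g xs) gs)" if "length xs = k" for xs
  proof -
    have "map (\<lambda>g. g xs) (map c gs) = map (\<lambda>g. g xs) gs"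
      using c(2) that by simp
    then show ?thesis
      using f'(2) by (metis length_map)
  qed
  ultimately show ?thesis
    unfolding rec_fn_def by blast
qed

lemma rec_fn_proj: "i < k \<Longrightarrow> rec_fn Z k (\<lambda>xs. xs ! i)"
  by (intro rec_fnI recursive_in.proj)

lemma rec_fn_comp1:
  assumes "rec_fn Z 1 (\<lambda>xs. f (xs ! 0))" "rec_fn Z k g"
  shows "rec_fn Z k (\<lambda>xs. f (g xs))"
  using rec_fn_comp[of Z "[g]" "\<lambda>xs. f (xs ! 0)" k] assms by simp

lemma rec_fn_drop:
  assumes "rec_fn Z k f"
  shows "rec_fn Z (m + k) (\<lambda>xs. f (drop m xs))"
proof -
  have "rec_fn Z (m + k) (\<lambda>xs. f (map (\<lambda>g. g xs) (map (\<lambda>i xs. xs ! i) [m..<m + k])))"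
    using assms by (intro rec_fn_comp) (auto intro: rec_fn_proj)
  then show ?thesis
    by (rule rec_fn_cong) (auto intro!: arg_cong[where f = f] nth_equalityI)
qed

text \<open>
  Primitive recursion in the form used on terms: the recursion runs up to a computed bound \<open>h xs\<close> and
  keeps all of \<open>xs\<close> as parameters.
\<close>

lemma rec_fn_prim_rec:
  assumes f: "rec_fn Z k f" and g: "rec_fn Z (Suc (Suc k)) g" and h: "rec_fn Z k h"
  shows "rec_fn Z k (\<lambda>xs. rec_nat (f xs) (\<lambda>y r. g (y # r # xs)) (h xs))"
proof -
  obtain f' where f': "recursive_in Z k f'" "\<And>xs. length xs = k \<Longrightarrow> f' xs = f xs"
    using f unfolding rec_fn_def by blast
  obtain g' where g': "recursive_in Z (Suc (Suc k)) g'"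
      "\<And>xs. length xs = Suc (Suc k) \<Longrightarrow> g' xs = g xs"
    using g unfolding rec_fn_def by blast
  define F where "F = (\<lambda>xs. rec_nat (f' (tl xs)) (\<lambda>y r. g' (y # r # tl xs)) (hd xs))"
  let ?ps = "h # map (\<lambda>i xs. xs ! i) [0..<k]"
  have "recursive_in Z (Suc k) F"
    unfolding F_def using f'(1) g'(1) by (rule recursive_in.prim_rec)
  then have "rec_fn Z k (\<lambda>xs. F (map (\<lambda>g. g xs) ?ps))"
    using h by (intro rec_fn_comp) (auto intro: rec_fnI rec_fn_proj)
  then show ?thesis
  proof (rule rec_fn_cong)
    fix xs :: "nat list" assume len: "length xs = k"
    have "map (\<lambda>g. g xs) ?ps = h xs # xs"
      using len by (auto intro!: nth_equalityI)
    moreover have "rec_nat (f' xs) (\<lambda>y r. g' (y # r # xs)) m = rec_nat (f xs) (\<lambda>y r. g (y # r # xs)) m" for m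
      by (induction m) (simp_all add: f'(2) g'(2) len)
    ultimately show "F (map (\<lambda>g. g xs) ?ps) = rec_nat (f xs) (\<lambda>y r. g (y # r # xs)) (h xs)"
      unfolding F_def by (metis list.sel(1,3))
  qed
qed

lemma rec_fn_least:
  assumes g: "rec_fn Z (Suc k) g" and ex: "\<And>xs. length xs = k \<Longrightarrow> \<exists>y. g (y # xs) = 0"
  shows "rec_fn Z k (\<lambda>xs. LEAST y. g (y # xs) = 0)"
proof -
  obtain g' where g': "recursive_in Z (Suc k) g'" "\<And>xs. length xs = Suc k \<Longrightarrow> g' xs = g xs"
    using g unfolding rec_fn_def by blast
  have "recursive_in Z k (\<lambda>xs. LEAST y. g' (y # xs) = 0)"
    using g' ex by (intro recursive_in.mu) auto
  then show ?thesis
    using g'(2) unfolding rec_fn_def by (intro exI[of _ "\<lambda>xs. LEAST y. g' (y # xs) = 0"]) simp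
qed

lemma rec_fn_Suc: "rec_fn Z k f \<Longrightarrow> rec_fn Z k (\<lambda>xs. Suc (f xs))"
  by (rule rec_fn_comp1[OF rec_fnI[OF recursive_in.succ]])

lemma rec_fn_const: "rec_fn Z k (\<lambda>xs. c)"
  by (induction c) (auto intro: rec_fn_Suc rec_fnI recursive_in.zero)

lemma rec_fn_if_zero:
  assumes "rec_fn Z k b" "rec_fn Z k f" "rec_fn Z k g"
  shows "rec_fn Z k (\<lambda>xs. if b xs = 0 then f xs else g xs)"
proof -
  have "rec_fn Z (Suc (Suc k)) (\<lambda>ys. g (drop 2 ys))"
    using rec_fn_drop[OF assms(3), of 2] by simp
  note rec_fn_prim_rec[OF assms(2) this assms(1)]
  then show ?thesis
  proof (rule rec_fn_cong)
    fix xs :: "nat list"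
    show "rec_nat (f xs) (\<lambda>y r. g (drop 2 (y # r # xs))) (b xs) = (if b xs = 0 then f xs else g xs)"
      by (cases "b xs") simp_all
  qed
qed

lemma rec_fn_if_oracle:
  assumes "rec_fn Z k b" "rec_fn Z k f" "rec_fn Z k g"
  shows "rec_fn Z k (\<lambda>xs. if b xs \<in> Z then f xs else g xs)"
proof -
  have "rec_fn Z k (\<lambda>xs. if b xs \<in> Z then 1 else 0)"
    by (rule rec_fn_comp1[OF rec_fnI[OF recursive_in.oracle_query] assms(1)])
  from rec_fn_if_zero[OF this assms(3,2)] show ?thesis
    by (rule rec_fn_cong) simp
qed

lemma rec_fn_funpow:
  assumes s: "rec_fn Z 1 (\<lambda>xs. s (xs ! 0))" and "rec_fn Z k h" "rec_fn Z k f"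
  shows "rec_fn Z k (\<lambda>xs. (s ^^ h xs) (f xs))"
proof -
  have "rec_fn Z (Suc (Suc k)) (\<lambda>ys. s (ys ! 1))"
    by (rule rec_fn_comp1[OF s rec_fn_proj]) simp
  note rec_fn_prim_rec[OF assms(3) this assms(2)]
  then show ?thesis
  proof (rule rec_fn_cong)
    fix xs :: "nat list"
    have "rec_nat (f xs) (\<lambda>y r. s ((y # r # xs) ! 1)) m = (s ^^ m) (f xs)" for m
      by (induction m) simp_all
    then show "rec_nat (f xs) (\<lambda>y r. s ((y # r # xs) ! 1)) (h xs) = (s ^^ h xs) (f xs)" .
  qed
qed

lemma rec_fn_add:
  assumes "rec_fn Z k f" "rec_fn Z k g"
  shows "rec_fn Z k (\<lambda>xs. f xs + g xs)"
proof -
  have "rec_fn Z k (\<lambda>xs. (Suc ^^ f xs) (g xs))"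
    using assms by (intro rec_fn_funpow rec_fn_Suc rec_fn_proj) auto
  then show ?thesis
    by (rule rec_fn_cong) simp
qed

lemma rec_fn_const_mult: "rec_fn Z k f \<Longrightarrow> rec_fn Z k (\<lambda>xs. c * f xs)"
  by (induction c) (auto intro: rec_fn_const rec_fn_add)

lemma rec_fn_pred:
  assumes "rec_fn Z k f"
  shows "rec_fn Z k (\<lambda>xs. f xs - 1)"
proof -
  have "rec_fn Z (Suc (Suc k)) (\<lambda>ys. ys ! 0)"
    by (rule rec_fn_proj) simp
  note rec_fn_prim_rec[OF rec_fn_const[of Z k 0] this assms]
  then show ?thesis
  proof (rule rec_fn_cong)
    fix xs :: "nat list"
    show "rec_nat 0 (\<lambda>y r. (y # r # xs) ! 0) (f xs) = f xs - 1"
      by (cases "f xs") simp_all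
  qed
qed

lemma rec_fn_diff:
  assumes "rec_fn Z k f" "rec_fn Z k g"
  shows "rec_fn Z k (\<lambda>xs. f xs - g xs)"
proof -
  have "rec_fn Z k (\<lambda>xs. ((\<lambda>x. x - 1) ^^ g xs) (f xs))"
    using assms by (intro rec_fn_funpow rec_fn_pred rec_fn_proj) auto
  moreover have "((\<lambda>x. x - 1) ^^ m) x = x - m" for m x :: nat
    by (induction m) simp_all
  ultimately show ?thesis
    by simp
qed

section \<open>Parsing coded words recursively\<close>

text \<open>
  The following functions act on codes as \<open>tl\<close>, \<open>drop j\<close> and \<open>take j\<close> act on words.  The code of \<open>u @ v\<close> is the
  code of \<open>u\<close> plus \<open>n ^ length u\<close> times the code of \<open>v\<close>, which is why a prefix is obtained by subtraction.
\<close>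

definition code_tl :: "nat \<Rightarrow> nat \<Rightarrow> nat" where
  "code_tl n c = (c - 1) div n"

definition code_drop :: "nat \<Rightarrow> nat \<Rightarrow> nat \<Rightarrow> nat" where
  "code_drop n j c = (code_tl n ^^ j) c"

definition code_take :: "nat \<Rightarrow> nat \<Rightarrow> nat \<Rightarrow> nat" where
  "code_take n j c = c - ((*) n ^^ j) (code_drop n j c)"

lemma rec_fn_code_tl:
  assumes "0 < n" "rec_fn Z k f"
  shows "rec_fn Z k (\<lambda>xs. code_tl n (f xs))"
proof -
  have "rec_fn Z (Suc 1) (\<lambda>ys. ys ! 1 - n * Suc (ys ! 0))"
    by (intro rec_fn_diff rec_fn_const_mult rec_fn_Suc rec_fn_proj) auto
  moreover have "\<exists>y. c \<le> n * Suc y" for c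
    by (rule exI[of _ c]) (use assms(1) in \<open>cases n; simp\<close>)
  ultimately have "rec_fn Z 1 (\<lambda>xs. LEAST y. (y # xs) ! 1 - n * Suc ((y # xs) ! 0) = 0)"
    by (intro rec_fn_least) (auto simp: numeral_2_eq_2)
  moreover have "(LEAST y. c - n * Suc y = 0) = code_tl n c" for c
  proof (rule Least_equality)
    have "c - 1 < n * Suc ((c - 1) div n)"
      using dividend_less_times_div[OF assms(1), of "c - 1"] by (simp add: algebra_simps)
    then show "c - n * Suc (code_tl n c) = 0"
      unfolding code_tl_def by linarith
    show "code_tl n c \<le> y" if "c - n * Suc y = 0" for y
    proof (cases "c = 0")
      case False
      then have "c - 1 < Suc y * n"
        using that by (simp add: mult.commute)
      then show ?thesis
        unfolding code_tl_def using less_mult_imp_div_less less_Suc_eq_le by blast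
    qed (simp add: code_tl_def)
  qed
  ultimately have "rec_fn Z 1 (\<lambda>xs. code_tl n (xs ! 0))"
    by simp
  then show ?thesis
    using assms(2) by (rule rec_fn_comp1)
qed

lemma rec_fn_code_drop:
  assumes "0 < n" "rec_fn Z k f" "rec_fn Z k g"
  shows "rec_fn Z k (\<lambda>xs. code_drop n (f xs) (g xs))"
  unfolding code_drop_def
  using assms by (intro rec_fn_funpow rec_fn_code_tl rec_fn_proj) auto

lemma rec_fn_code_take:
  assumes "0 < n" "rec_fn Z k f" "rec_fn Z k g"
  shows "rec_fn Z k (\<lambda>xs. code_take n (f xs) (g xs))"
  unfolding code_take_def
  using assms by (intro rec_fn_diff rec_fn_funpow rec_fn_const_mult rec_fn_code_drop rec_fn_proj) auto

lemma code_tl_word_code: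
  assumes "0 < n" "w \<in> lists {..<n}"
  shows "code_tl n (word_code n w) = word_code n (tl w)"
  using assms by (cases w) (auto simp: code_tl_def)

lemma code_drop_word_code:
  assumes "0 < n" "w \<in> lists {..<n}"
  shows "code_drop n j (word_code n w) = word_code n (drop j w)"
proof (induction j)
  case (Suc j)
  have "drop j w \<in> lists {..<n}"
    using assms(2) set_drop_subset by fastforce
  then show ?case
    using Suc code_tl_word_code[OF assms(1)] by (simp add: code_drop_def tl_drop drop_Suc)
qed (simp add: code_drop_def)

lemma word_code_append: "word_code n (u @ v) = word_code n u + n ^ length u * word_code n v"
  by (induction u) (simp_all add: algebra_simps)

lemma funpow_times: "((*) c ^^ j) x = c ^ j * (x :: nat)"
  by (induction j) (simp_all add: algebra_simps)

lemma code_take_word_code: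
  assumes "0 < n" "w \<in> lists {..<n}"
  shows "code_take n j (word_code n w) = word_code n (take j w)"
proof -
  have "n ^ length (take j w) * word_code n (drop j w) = n ^ j * word_code n (drop j w)"
    by (cases "j \<le> length w") (simp_all add: min_def)
  then have "word_code n w = word_code n (take j w) + n ^ j * word_code n (drop j w)"
    using word_code_append[of n "take j w" "drop j w"] by simp
  then show ?thesis
    unfolding code_take_def funpow_times code_drop_word_code[OF assms] by linarith
qed

lemma length_le_word_code:
  assumes "0 < n"
  shows "length w \<le> word_code n w"
proof (induction w)
  case (Cons x w)
  have "word_code n w \<le> n * word_code n w"
    using assms by (cases n) auto
  with Cons show ?case
    unfolding word_code.simps list.size by linarith
qed simp

text \<open>
  The length of the shortest prefix with code in \<open>Z\<close>, if there is one.  The search also stops at \<open>j = c\<close>, which makes the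
  minimization regular; a word is no longer than its code, so no prefix is missed.
\<close>

definition code_cut :: "nat \<Rightarrow> nat set \<Rightarrow> nat \<Rightarrow> nat" where
  "code_cut n Z c = (LEAST j. (if code_take n j c \<in> Z then 0 else c - j) = 0)"

text \<open>
  Removes the shortest prefix with code in \<open>Z\<close>.  Argument and result are codes shifted by one, 0 standing for
  failure, so that the function can be iterated.
\<close>

definition code_strip :: "nat \<Rightarrow> nat set \<Rightarrow> nat \<Rightarrow> nat" where
  "code_strip n Z r = (if r = 0 then 0
     else if code_take n (code_cut n Z (r - 1)) (r - 1) \<in> Z then Suc (code_drop n (code_cut n Z (r - 1)) (r - 1))
     else 0)"

lemma rec_fn_code_strip:
  assumes "0 < n"
  shows "rec_fn Z 1 (\<lambda>xs. code_strip n Z (xs ! 0))"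
proof -
  have "rec_fn Z (Suc 1) (\<lambda>ys. if code_take n (ys ! 0) (ys ! 1) \<in> Z then 0 else ys ! 1 - ys ! 0)"
    using assms
    by (intro rec_fn_if_oracle rec_fn_code_take rec_fn_const rec_fn_diff rec_fn_proj) auto
  then have "rec_fn Z 1 (\<lambda>xs. LEAST y. (if code_take n ((y # xs) ! 0) ((y # xs) ! 1) \<in> Z then 0
      else (y # xs) ! 1 - (y # xs) ! 0) = 0)"
    by (rule rec_fn_least) (rule exI, auto)
  then have "rec_fn Z 1 (\<lambda>xs. code_cut n Z (xs ! 0))"
    unfolding code_cut_def by (rule rec_fn_cong) simp
  then have cut: "rec_fn Z 1 (\<lambda>xs. code_cut n Z (xs ! 0 - 1))"
    by (rule rec_fn_comp1) (intro rec_fn_pred rec_fn_proj; simp)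
  then show ?thesis
    unfolding code_strip_def using assms
    by (intro rec_fn_if_zero rec_fn_if_oracle rec_fn_Suc rec_fn_code_drop rec_fn_code_take rec_fn_const
      rec_fn_pred rec_fn_proj cut) auto
qed

lemma code_strip_word_code:
  assumes n: "0 < n" and w: "w \<in> lists {..<n}" and A: "A \<subseteq> lists {..<n}"
  shows "code_strip n (word_code n ` A) (Suc (word_code n w)) =
    (if \<exists>j. take j w \<in> A then Suc (word_code n (drop (LEAST j. take j w \<in> A) w)) else 0)"
proof -
  let ?Z = "word_code n ` A"
  have take: "take j w \<in> lists {..<n}" for j
    using w set_take_subset by fastforce
  have mem: "code_take n j (word_code n w) \<in> ?Z \<longleftrightarrow> take j w \<in> A" for j
    using inj_on_image_mem_iff[OF bij_betw_imp_inj_on[OF bij_betw_word_code[OF n]] take A]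
    by (simp add: code_take_word_code[OF n w])
  show ?thesis
  proof (cases "\<exists>j. take j w \<in> A")
    case True
    have "code_cut n ?Z (word_code n w) = (LEAST j. take j w \<in> A)"
      unfolding code_cut_def
    proof (rule Least_equality)
      show "(if code_take n (LEAST j. take j w \<in> A) (word_code n w) \<in> ?Z then 0
          else word_code n w - (LEAST j. take j w \<in> A)) = 0"
        using LeastI_ex[OF True] mem by simp
      fix j assume j: "(if code_take n j (word_code n w) \<in> ?Z then 0 else word_code n w - j) = 0"
      obtain i where "take i w \<in> A"
        using True by blast
      moreover have "take j w = w" if "word_code n w \<le> j"
        using that length_le_word_code[OF n, of w] by simp
      moreover have "take i w \<in> A \<Longrightarrow> (LEAST j. take j w \<in> A) \<le> length w"
        by (cases "i \<le> length w") (auto intro: Least_le[THEN order_trans] simp: Least_le)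
      ultimately show "(LEAST j. take j w \<in> A) \<le> j"
        using j length_le_word_code[OF n, of w] by (auto simp: mem split: if_splits intro: Least_le)
    qed
    then show ?thesis
      using True LeastI_ex[OF True] by (simp add: code_strip_def mem code_drop_word_code[OF n w])
  next
    case False
    then show ?thesis
      by (simp add: code_strip_def mem)
  qed
qed

text \<open>
  For an antichain at most one prefix of \<open>w\<close> lies in \<open>A\<close>, so the greedy removal of the shortest one
  finds a parse whenever there is one.
\<close>

lemma funpow_code_strip:
  assumes n: "0 < n" and A: "A \<subseteq> lists {..<n}" "word_antichain A" and w: "w \<in> lists {..<n}"
  shows "(code_strip n (word_code n ` A) ^^ m) (Suc (word_code n w)) \<noteq> 0 \<longleftrightarrow>
    (\<exists>us. length us = m \<and> us \<in> lists A \<and> Sublist.prefix (concat us) w)"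
  using w
proof (induction m arbitrary: w)
  case (Suc m)
  let ?s = "code_strip n (word_code n ` A)"
  have zero: "(?s ^^ i) 0 = 0" for i
    by (induction i) (simp_all add: code_strip_def)
  show ?case
  proof (cases "\<exists>j. take j w \<in> A")
    case True
    define J where "J = (LEAST j. take j w \<in> A)"
    have J: "take J w \<in> A"
      unfolding J_def using True by (rule LeastI_ex)
    have "drop J w \<in> lists {..<n}"
      using Suc.prems set_drop_subset by fastforce
    then have IH: "(?s ^^ Suc m) (Suc (word_code n w)) \<noteq> 0 \<longleftrightarrow>
        (\<exists>us. length us = m \<and> us \<in> lists A \<and> Sublist.prefix (concat us) (drop J w))"
      using Suc.IH[of "drop J w"] code_strip_word_code[OF n Suc.prems A(1)] True
      by (simp only: funpow_Suc_right o_apply if_True J_def)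
    show ?thesis
      unfolding IH
    proof
      assume "\<exists>us. length us = m \<and> us \<in> lists A \<and> Sublist.prefix (concat us) (drop J w)"
      then obtain us where us: "length us = m" "us \<in> lists A" "Sublist.prefix (concat us) (drop J w)"
        by blast
      then have "Sublist.prefix (concat (take J w # us)) w"
        using append_take_drop_id[of J w] by (metis concat.simps(2) same_prefix_prefix)
      then show "\<exists>us. length us = Suc m \<and> us \<in> lists A \<and> Sublist.prefix (concat us) w"
        using us J by (intro exI[of _ "take J w # us"]) simp
    next
      assume "\<exists>us. length us = Suc m \<and> us \<in> lists A \<and> Sublist.prefix (concat us) w"
      then obtain vs where vs: "length vs = Suc m" "vs \<in> lists A" "Sublist.prefix (concat vs) w"
        by blast
      then obtain u us where "vs = u # us"
        by (cases vs) auto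
      with vs have us: "length us = m" "u \<in> A" "us \<in> lists A" "Sublist.prefix (u @ concat us) w"
        by simp_all
      then have "Sublist.prefix u w"
        using append_prefixD by blast
      then have "u = take J w"
        using prefix_same_cases[OF _ take_is_prefix, of u w J] by (intro word_antichainD[OF A(2) us(2) J])
      then have "Sublist.prefix (concat us) (drop J w)"
        using us(4) append_take_drop_id[of J w] by (metis same_prefix_prefix)
      then show "\<exists>us. length us = m \<and> us \<in> lists A \<and> Sublist.prefix (concat us) (drop J w)"
        using us by blast
    qed
  next
    case False
    then have "(?s ^^ Suc m) (Suc (word_code n w)) = 0"
      using code_strip_word_code[OF n Suc.prems A(1)] zero by (simp only: funpow_Suc_right o_apply if_False)
    moreover have "\<not> Sublist.prefix (concat us) w" if us: "length us = Suc m" "us \<in> lists A" for us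
    proof
      assume "Sublist.prefix (concat us) w"
      moreover obtain u vs where "us = u # vs"
        using us(1) by (cases us) auto
      ultimately have "u \<in> A" "take (length u) w = u"
        using us(2) by (auto elim!: prefixE)
      then show False
        using False by metis
    qed
    ultimately show ?thesis
      by blast
  qed
qed (auto intro: exI[of _ "[]"])

lemma lightface_Pi02_omega_power:
  assumes n: "0 < n" and A: "A \<subseteq> lists {..<n}" "word_antichain A" "[] \<notin> A"
  shows "lightface_Pi02 n A (omega_power A)"
proof -
  let ?Z = "word_code n ` A" and ?X = "topspace (omega_words n)"
  define T where "T xs = (code_strip n ?Z ^^ (xs ! 0)) (Suc (xs ! 1))" for xs
  have "rec_fn ?Z 2 (\<lambda>xs. if T xs = 0 then 1 else 0)"
    unfolding T_def using n
    by (intro rec_fn_if_zero rec_fn_funpow rec_fn_code_strip rec_fn_Suc rec_fn_const rec_fn_proj) auto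
  then obtain R where R: "recursive_in ?Z 2 R"
      "\<And>xs. length xs = 2 \<Longrightarrow> R xs = (if T xs = 0 then 1 else 0)"
    unfolding rec_fn_def by blast
  define P where "P = {(m, \<alpha>). \<alpha> \<in> ?X \<and> (\<exists>k. R [m, word_code n (restr \<alpha> k)] = 0)}"
  have "(m, \<alpha>) \<in> P \<longleftrightarrow> (\<exists>k us. length us = m \<and> us \<in> lists A \<and> Sublist.prefix (concat us) (restr \<alpha> k))"
    if "\<alpha> \<in> ?X" for m \<alpha>
  proof -
    have "restr \<alpha> k \<in> lists {..<n}" for k
      using that by (auto simp: restr_def topspace_omega_words)
    then show ?thesis
      using funpow_code_strip[OF n A(1,2)] that by (simp add: P_def R(2) T_def)
  qed
  then have "omega_power A = {\<alpha> \<in> ?X. \<forall>m. (m, \<alpha>) \<in> P}"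
    using omega_power_iff_prefixes[OF A(2,3)] omega_power_subset_topspace[OF A(1)] by auto
  moreover have "lightface_Sigma01 n A P"
    unfolding lightface_Sigma01_def P_def using R(1) by blast
  ultimately show ?thesis
    unfolding lightface_Pi02_def by blast
qed

theorem antichain_omega_power_cases:
  assumes n: "0 < n" and A: "A \<subseteq> lists {..<n}" "word_antichain A"
  shows "omega_power A = {} \<or> omega_power A = topspace (omega_words n) \<or>
    closedin (omega_words n) (omega_power A) \<and> \<not> openin (omega_words n) (omega_power A) \<or>
    lightface_Pi02 n A (omega_power A) \<and> \<not> fsigma_in (omega_words n) (omega_power A)"
proof (cases "[] \<in> A")
  case True
  then have "A \<subseteq> {[]}"
    using word_antichainD[OF A(2)] by fastforce
  then show ?thesis
    using omega_power_of_Nil by blast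
next
  case False
  then show ?thesis
    using antichain_not_closed_imp_not_fsigma[OF A] antichain_open_imp_all[OF A]
      lightface_Pi02_omega_power[OF n A] by blast
qed

section \<open>Sets of words without infinite antichains\<close>

text \<open>
  Otherwise words of \<open>A\<close> branch off \<open>\<gamma>\<close> arbitrarily late.  Choose each one to follow \<open>\<gamma>\<close> for at least the
  length of its predecessor: it then disagrees with the predecessor where the latter left \<open>\<gamma>\<close>, and the
  words so chosen are the teeth of a comb, pairwise incomparable.
\<close>

lemma finite_antichains_imp_isolated:
  assumes fin: "\<And>B. B \<subseteq> A \<Longrightarrow> word_antichain B \<Longrightarrow> finite B"
  shows "\<exists>k. \<forall>a \<in> A. Sublist.prefix (subsequence \<gamma> 0 k) a \<longrightarrow> a = subsequence \<gamma> 0 (length a)"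
proof (rule ccontr)
  assume "\<not> ?thesis"
  then obtain f where f: "\<And>k. f k \<in> A" "\<And>k. Sublist.prefix (subsequence \<gamma> 0 k) (f k)"
      "\<And>k. f k \<noteq> subsequence \<gamma> 0 (length (f k))"
    by metis
  define b where "b = rec_nat (f 0) (\<lambda>_ w. f (length w))"
  have b_Suc: "b (Suc i) = f (length (b i))" for i
    by (simp add: b_def)
  have b_A: "b i \<in> A" and b_off: "b i \<noteq> subsequence \<gamma> 0 (length (b i))" for i
    using f(1,3) by (cases i; simp add: b_def)+
  have b_pre: "Sublist.prefix (subsequence \<gamma> 0 (length (b i))) (b (Suc i))" for i
    unfolding b_Suc by (rule f(2))
  have "length (b i) \<le> length (b (Suc i))" for i
    using prefix_length_le[OF b_pre[of i]] by simp
  then have len_mono: "i \<le> j \<Longrightarrow> length (b i) \<le> length (b j)" for i j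
    by (rule lift_Suc_mono_le)
  have par: "\<not> Sublist.prefix (b i) (b j) \<and> \<not> Sublist.prefix (b j) (b i)" if ij: "i < j" for i j
  proof -
    obtain j' where j': "j = Suc j'" "i \<le> j'"
      using ij by (cases j) auto
    have "Sublist.prefix (subsequence \<gamma> 0 (length (b i))) (subsequence \<gamma> 0 (length (b j')))"
      using take_is_prefix[of "length (b i)" "subsequence \<gamma> 0 (length (b j'))"] len_mono[OF j'(2)]
      by (simp add: min_def)
    then have pre: "Sublist.prefix (subsequence \<gamma> 0 (length (b i))) (b j)"
      unfolding j'(1) using b_pre[of j'] by (rule prefix_order.trans)
    have "\<not> Sublist.prefix (b i) (b j)"
    proof
      assume "Sublist.prefix (b i) (b j)"
      then have "b i = take (length (b i)) (b j)"
        by (auto elim: prefixE)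
      also have "\<dots> = subsequence \<gamma> 0 (length (b i))"
        using pre by (auto elim!: prefixE)
      finally show False
        using b_off by blast
    qed
    moreover have "b j = b i" if "Sublist.prefix (b j) (b i)"
      using that len_mono[of i j] ij by (auto elim!: prefixE)
    ultimately show ?thesis
      by auto
  qed
  have neq: "b i \<parallel> b j" if "i \<noteq> j" for i j
    using par[of i j] par[of j i] that unfolding parallel_def by (metis linorder_neqE_nat)
  then have "inj b"
    by (metis injI parallel_def prefix_order.refl)
  moreover have "finite (range b)"
  proof (rule fin)
    show "word_antichain (range b)"
      unfolding word_antichain_def pairwise_def by (metis neq rangeE)
  qed (use b_A in blast)
  ultimately show False
    using finite_imageD infinite_UNIV_nat by blast
qed

text \<open>
  Words of \<open>A\<close> that extend a suitable initial segment of \<open>\<gamma>\<close> are prefixes of \<open>\<gamma>\<close>.  A limit of words of \<open>A\<close>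
  with that initial segment therefore equals \<open>\<gamma>\<close>, and the initial segment determines the limit.
\<close>

lemma countable_limits:
  assumes fin: "\<And>B. B \<subseteq> A \<Longrightarrow> word_antichain B \<Longrightarrow> finite B"
  shows "countable {\<gamma>. \<forall>k. \<exists>q\<ge>k. subsequence \<gamma> 0 q \<in> A}" (is "countable ?L")
proof -
  obtain K where K: "\<And>\<gamma> a. a \<in> A \<Longrightarrow> Sublist.prefix (subsequence \<gamma> 0 (K \<gamma>)) a \<Longrightarrow> a = subsequence \<gamma> 0 (length a)"
    using finite_antichains_imp_isolated[OF fin] by metis
  have "inj_on (\<lambda>\<gamma>. subsequence \<gamma> 0 (K \<gamma>)) ?L"
  proof (rule inj_onI)
    fix \<gamma> \<delta> assume \<delta>: "\<delta> \<in> ?L" and eq: "subsequence \<gamma> 0 (K \<gamma>) = subsequence \<delta> 0 (K \<delta>)"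
    show "\<gamma> = \<delta>"
    proof
      fix i
      obtain q where q: "q \<ge> max (K \<gamma>) (Suc i)" "subsequence \<delta> 0 q \<in> A"
        using \<delta> by blast
      have "K \<gamma> = K \<delta>"
        using arg_cong[OF eq, of length] by simp
      then have "take (K \<gamma>) (subsequence \<delta> 0 q) = subsequence \<gamma> 0 (K \<gamma>)"
        using eq q(1) by (simp add: min_def)
      then have "Sublist.prefix (subsequence \<gamma> 0 (K \<gamma>)) (subsequence \<delta> 0 q)"
        by (metis take_is_prefix)
      then have "subsequence \<delta> 0 q = subsequence \<gamma> 0 q"
        using K[OF q(2)] by simp
      then show "\<gamma> i = \<delta> i"
        using q(1) by (simp add: initial_segments_eq_iff)
    qed
  qed
  then show ?thesis
    using countableI_type countable_image_inj_on by blast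
qed

text \<open>
  Koenig's lemma for the graph of cut positions: from a vertex that reaches infinitely many vertices,
  one of its finitely many successors again reaches infinitely many.
\<close>

lemma omega_power_if_finitely_branching:
  assumes fin: "\<And>p. finite {q. (p, q) \<in> steps A \<alpha>}"
    and inf: "infinite {q. (0, q) \<in> (steps A \<alpha>)\<^sup>*}"
  shows "\<alpha> \<in> omega_power A"
proof -
  let ?E = "steps A \<alpha>"
  have next_step: "\<exists>y. infinite {q. (y, q) \<in> ?E\<^sup>*} \<and> (x, y) \<in> ?E" if "infinite {q. (x, q) \<in> ?E\<^sup>*}" for x
  proof (rule ccontr)
    assume "\<not> ?thesis"
    then have "finite (insert x (\<Union>y \<in> {y. (x, y) \<in> ?E}. {q. (y, q) \<in> ?E\<^sup>*}))"
      using fin by auto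
    moreover have "{q. (x, q) \<in> ?E\<^sup>*} \<subseteq> insert x (\<Union>y \<in> {y. (x, y) \<in> ?E}. {q. (y, q) \<in> ?E\<^sup>*})"
      by (auto elim: converse_rtranclE)
    ultimately show False
      using that finite_subset by blast
  qed
  have "\<exists>p. \<forall>i. (infinite {q. (p i, q) \<in> ?E\<^sup>*} \<and> (i = 0 \<longrightarrow> p i = 0)) \<and> (p i, p (Suc i)) \<in> ?E"
  proof (rule dependent_nat_choice)
    show "\<exists>x. infinite {q. (x, q) \<in> ?E\<^sup>*} \<and> (0 = 0 \<longrightarrow> x = 0)"
      using inf by blast
  qed (use next_step in auto)
  then show ?thesis
    using omega_powerI by metis
qed

theorem finite_antichains_imp_gdelta:
  assumes A: "A \<subseteq> lists {..<n}" and fin: "\<And>B. B \<subseteq> A \<Longrightarrow> word_antichain B \<Longrightarrow> finite B"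
  shows "gdelta_in (omega_words n) (omega_power A)"
proof -
  let ?X = "topspace (omega_words n)"
  define L where "L = {\<gamma>. \<forall>k. \<exists>q\<ge>k. subsequence \<gamma> 0 q \<in> A}"
  define C where "C = (\<lambda>(w, \<gamma>). w \<frown> \<gamma>) ` (UNIV \<times> L)"
  define G where "G m = {\<alpha> \<in> ?X. \<exists>k\<ge>m. subsequence \<alpha> 0 k \<in> concat ` lists A}" for m
  have "countable C"
    unfolding C_def L_def using countable_limits[OF fin] by (intro countable_image countable_SIGMA) auto
  have fin_succ: "finite {q. (p, q) \<in> steps A \<alpha>}" if "\<alpha> \<notin> C" for \<alpha> p
  proof (rule ccontr)
    assume inf: "infinite {q. (p, q) \<in> steps A \<alpha>}"
    have "suffix p \<alpha> \<in> L"
      unfolding L_def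
    proof (intro CollectI allI)
      fix k
      obtain q where q: "q \<ge> p + k" "(p, q) \<in> steps A \<alpha>"
        using inf unfolding infinite_nat_iff_unbounded_le by blast
      then have "subsequence (suffix p \<alpha>) 0 (q - p) \<in> A"
        by (simp add: steps_def)
      then show "\<exists>q\<ge>k. subsequence (suffix p \<alpha>) 0 q \<in> A"
        using q(1) by (intro exI[of _ "q - p"]) auto
    qed
    then have "\<alpha> \<in> C"
      unfolding C_def by (intro image_eqI[of _ _ "(subsequence \<alpha> 0 p, suffix p \<alpha>)"]) auto
    then show False
      using that by blast
  qed
  have reached: "\<alpha> \<in> omega_power A" if \<alpha>: "\<And>m. \<alpha> \<in> G m" "\<alpha> \<notin> C" for \<alpha>
  proof (rule omega_power_if_finitely_branching[OF fin_succ[OF \<alpha>(2)]])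
    show "infinite {q. (0, q) \<in> (steps A \<alpha>)\<^sup>*}"
      unfolding infinite_nat_iff_unbounded_le
    proof
      fix m
      obtain k us where k: "k \<ge> m" "us \<in> lists A" "subsequence \<alpha> 0 k = concat us"
        using \<alpha>(1)[of m] unfolding G_def by blast
      have "\<alpha> = concat us \<frown> suffix k \<alpha>"
        unfolding k(3)[symmetric] by simp
      moreover have "length (concat us) = k"
        unfolding k(3)[symmetric] by simp
      ultimately have "(0, k) \<in> (steps A \<alpha>)\<^sup>*"
        using rtrancl_steps_conc[OF k(2), of "[]" "suffix k \<alpha>"] by simp
      then show "\<exists>k\<ge>m. k \<in> {q. (0, q) \<in> (steps A \<alpha>)\<^sup>*}"
        using k(1) by blast
    qed
  qed
  have prefixes: "\<alpha> \<in> G m" if \<alpha>: "\<alpha> \<in> omega_power A" for \<alpha> m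
  proof -
    obtain us where us: "us \<in> lists A" "m < length (concat us)" "concat us = subsequence \<alpha> 0 (length (concat us))"
      using omega_power_prefix_long[OF \<alpha>] by metis
    then have "subsequence \<alpha> 0 (length (concat us)) \<in> concat ` lists A"
      by (metis imageI)
    then show ?thesis
      using \<alpha> us(2) omega_power_subset_topspace[OF A] unfolding G_def by (auto intro: less_imp_le)
  qed
  have "(\<Inter>m. G m) - C \<subseteq> omega_power A"
  proof
    fix \<alpha> assume "\<alpha> \<in> (\<Inter>m. G m) - C"
    then show "\<alpha> \<in> omega_power A"
      by (intro reached) simp_all
  qed
  moreover have "omega_power A \<subseteq> (\<Inter>m. G m)"
    by (intro INT_greatest subsetI prefixes)
  moreover have "(\<Inter>m. G m) \<subseteq> ?X"
    by (rule INF_lower2[of 0]) (auto simp: G_def)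
  ultimately have "omega_power A = (\<Inter>m. G m) - (?X \<inter> C - omega_power A)"
    by blast
  moreover have "gdelta_in (omega_words n) (\<Inter>m. G m)"
  proof (intro gdelta_in_Inter)
    fix S assume "S \<in> range G"
    then obtain m where S: "S = G m"
      by blast
    have "openin (omega_words n) (G m)"
      unfolding openin_omega_words
    proof (intro conjI ballI)
      fix \<alpha> assume "\<alpha> \<in> G m"
      then obtain k where "k \<ge> m" "subsequence \<alpha> 0 k \<in> concat ` lists A"
        unfolding G_def by blast
      then show "\<exists>k. \<forall>\<beta>\<in>?X. subsequence \<alpha> 0 k = subsequence \<beta> 0 k \<longrightarrow> \<beta> \<in> G m"
        unfolding G_def by (intro exI[of _ k] ballI impI CollectI conjI) simp_all
    qed (auto simp: G_def)
    then show "gdelta_in (omega_words n) S"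
      unfolding S by (rule open_imp_gdelta_in)
  qed auto
  moreover have "fsigma_in (omega_words n) (?X \<inter> C - omega_power A)"
  proof -
    let ?D = "?X \<inter> C - omega_power A"
    have "countable ?D"
      using \<open>countable C\<close> by (rule countable_subset[rotated]) blast
    then have "fsigma_in (omega_words n) (\<Union> ((\<lambda>\<alpha>. {\<alpha>}) ` ?D))"
      by (intro fsigma_in_Union) (auto intro: closed_imp_fsigma_in closedin_omega_words_singleton)
    then show ?thesis
      by simp
  qed
  ultimately show ?thesis
    by (metis gdelta_in_diff)
qed

section \<open>Examples\<close>

lemma constant_in_omega_power: "[x] \<in> A \<Longrightarrow> (\<lambda>_. x) \<in> omega_power A"
  by (rule omega_powerI[where p = "\<lambda>i. i"]) (auto simp: steps_def)

lemma omega_power_letter_recurs: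
  assumes "\<alpha> \<in> omega_power A" "\<And>w. w \<in> A \<Longrightarrow> x \<in> set w"
  shows "\<exists>i\<ge>k. \<alpha> i = x"
proof -
  obtain p where p: "p 0 = 0" "\<And>i. (p i, p (Suc i)) \<in> steps A \<alpha>"
    using assms(1) by (rule omega_powerE) blast
  have "subsequence \<alpha> (p k) (p (Suc k)) \<in> A"
    using p(2) by (simp add: steps_def)
  then have "x \<in> \<alpha> ` {p k..<p (Suc k)}"
    using assms(2) by fastforce
  then obtain i where "p k \<le> i" "\<alpha> i = x"
    by auto
  moreover have "k \<le> p k"
    using p(2) by (rule steps_path_ge)
  ultimately show ?thesis
    using le_trans by blast
qed

text \<open>
  Elements of the power contain \<open>x\<close> infinitely often and \<open>w \<frown> \<gamma>\<close> does not, so the translates of \<open>\<gamma>\<close>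
  avoid the power; the words \<open>u \<frown> xxx\<dots>\<close> show that \<open>\<gamma>\<close> is in its closure.
\<close>

lemma not_fsigma_if_letter_avoided:
  assumes A: "A \<subseteq> lists {..<n}" "[x] \<in> A" "\<And>w. w \<in> A \<Longrightarrow> x \<in> set w"
    and \<gamma>: "\<gamma> \<in> topspace (omega_words n)" "\<And>i. 0 < i \<Longrightarrow> \<gamma> i \<noteq> x"
    and limit: "\<And>k. \<exists>u \<in> A. k \<le> length u \<and> take k u = subsequence \<gamma> 0 k"
  shows "\<not> fsigma_in (omega_words n) (omega_power A)"
proof (rule not_fsigma_in_omega_power[OF A(1) \<gamma>(1)])
  show "concat us \<frown> \<gamma> \<notin> omega_power A" for us
  proof
    assume "concat us \<frown> \<gamma> \<in> omega_power A"
    then obtain i where i: "i \<ge> Suc (length (concat us))" "(concat us \<frown> \<gamma>) i = x"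
      using omega_power_letter_recurs[OF _ A(3)] by blast
    then have "\<gamma> (i - length (concat us)) = x"
      by (simp add: conc_def split: if_splits del: length_concat)
    then show False
      using \<gamma>(2)[of "i - length (concat us)"] i(1) by linarith
  qed
  fix k
  obtain u where u: "u \<in> A" "k \<le> length u" "take k u = subsequence \<gamma> 0 k"
    using limit by blast
  then have "subsequence (u \<frown> (\<lambda>_. x)) 0 k = subsequence \<gamma> 0 k"
    by simp
  then show "\<exists>\<beta> \<in> omega_power A. subsequence \<beta> 0 k = subsequence \<gamma> 0 k"
    using omega_power_conc[OF u(1) constant_in_omega_power[OF A(2)]] by blast
qed

lemma omega_power_letters: "omega_power ((\<lambda>i. [i]) ` {..<n}) = topspace (omega_words n)"
proof
  show "omega_power ((\<lambda>i. [i]) ` {..<n}) \<subseteq> topspace (omega_words n)"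
    by (rule omega_power_subset_topspace) auto
  show "topspace (omega_words n) \<subseteq> omega_power ((\<lambda>i. [i]) ` {..<n})"
  proof
    fix \<alpha> assume "\<alpha> \<in> topspace (omega_words n)"
    then show "\<alpha> \<in> omega_power ((\<lambda>i. [i]) ` {..<n})"
      by (intro omega_powerI[where p = "\<lambda>i. i"]) (auto simp: steps_def topspace_omega_words)
  qed
qed

text \<open>
  The only infinite word over a one-letter alphabet is constant.
\<close>

lemma omega_power_singleton_letter: "omega_power {[0]} = {\<lambda>_. 0}"
proof
  have "omega_power {[0]} \<subseteq> topspace (omega_words 1)"
    by (rule omega_power_subset_topspace) auto
  then show "omega_power {[0]} \<subseteq> {\<lambda>_. 0}"
    by (auto simp: topspace_omega_words subset_iff)
qed (simp add: constant_in_omega_power)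

lemma zeros_closed_not_open:
  assumes "2 \<le> n"
  shows "closedin (omega_words n) {\<lambda>_. 0}" "\<not> openin (omega_words n) {\<lambda>_. 0}"
proof -
  show "closedin (omega_words n) {\<lambda>_. 0}"
    using assms by (intro closedin_omega_words_singleton) (simp add: topspace_omega_words)
  show "\<not> openin (omega_words n) {\<lambda>_. 0}"
  proof
    assume "openin (omega_words n) {\<lambda>_. 0}"
    then obtain k where k: "\<forall>\<beta>\<in>topspace (omega_words n). subsequence (\<lambda>_. 0) 0 k = subsequence \<beta> 0 k \<longrightarrow> \<beta> = (\<lambda>_. 0)"
      unfolding openin_omega_words by blast
    have "(\<lambda>i. if i < k then 0 else 1) = (\<lambda>_. 0 :: nat)"
      using assms by (intro k[rule_format]) (auto simp: topspace_omega_words initial_segments_eq_iff)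
    then show False
      using fun_cong[of _ _ k] by fastforce
  qed
qed

definition ones_zero :: "nat list set" where
  "ones_zero = range (\<lambda>k. replicate k 1 @ [0])"

definition zero_ones :: "nat list set" where
  "zero_ones = range (\<lambda>k. 0 # replicate k 1)"

lemma ones_zero_antichain: "word_antichain ones_zero"
proof -
  have "\<not> Sublist.prefix (replicate j 1 @ [0 :: nat]) (replicate k 1 @ [0])" if "j \<noteq> k" for j k
  proof
    assume pre: "Sublist.prefix (replicate j 1 @ [0 :: nat]) (replicate k 1 @ [0])"
    then have "j < k"
      using prefix_length_le[OF pre] that by simp
    moreover have "(replicate k 1 @ [0 :: nat]) ! j = 0"
      using pre by (metis append_assoc append_Cons length_replicate nth_append_length prefixE)
    ultimately show False
      by (simp add: nth_append)
  qed
  then show ?thesis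
    unfolding word_antichain_def pairwise_def ones_zero_def parallel_def by auto
qed

lemma ones_zero_not_fsigma:
  assumes "2 \<le> n"
  shows "ones_zero \<subseteq> lists {..<n}" "\<not> fsigma_in (omega_words n) (omega_power ones_zero)"
proof -
  show sub: "ones_zero \<subseteq> lists {..<n}"
    using assms by (auto simp: ones_zero_def)
  show "\<not> fsigma_in (omega_words n) (omega_power ones_zero)"
  proof (rule not_fsigma_if_letter_avoided[OF sub, where x = 0 and \<gamma> = "\<lambda>_. 1"])
    show "[0] \<in> ones_zero"
      unfolding ones_zero_def by (rule range_eqI[of _ _ 0]) simp
    show "\<exists>u\<in>ones_zero. k \<le> length u \<and> take k u = subsequence (\<lambda>_. 1) 0 k" for k
      unfolding ones_zero_def subsequence_def
      by (intro bexI[of _ "replicate k 1 @ [0]"]) (auto simp: map_replicate_const)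
  qed (use assms in \<open>auto simp: ones_zero_def topspace_omega_words\<close>)
qed

lemma finite_antichain_in_zero_ones:
  assumes "B \<subseteq> zero_ones" "word_antichain B"
  shows "finite B"
proof -
  have comparable: "Sublist.prefix u v \<or> Sublist.prefix v u" if uv: "u \<in> zero_ones" "v \<in> zero_ones" for u v
  proof -
    obtain j k where "u = 0 # replicate j 1" "v = 0 # replicate k 1"
      using uv unfolding zero_ones_def by blast
    moreover have "Sublist.prefix (replicate j (1::nat)) (replicate k 1)" if "j \<le> k" for j k
      using that by (metis le_add_diff_inverse prefixI replicate_add)
    ultimately show ?thesis
      using nat_le_linear[of j k] by (metis Cons_prefix_Cons)
  qed
  then have "u = v" if "u \<in> B" "v \<in> B" for u v
    using that assms by (meson subsetD word_antichainD)
  then have "B = {} \<or> (\<exists>u. B = {u})"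
    by blast
  then show ?thesis
    by auto
qed

lemma zero_ones_not_fsigma:
  assumes "2 \<le> n"
  shows "zero_ones \<subseteq> lists {..<n}" "\<not> fsigma_in (omega_words n) (omega_power zero_ones)"
proof -
  show sub: "zero_ones \<subseteq> lists {..<n}"
    using assms by (auto simp: zero_ones_def)
  show "\<not> fsigma_in (omega_words n) (omega_power zero_ones)"
  proof (rule not_fsigma_if_letter_avoided[OF sub, where x = 0 and \<gamma> = "case_nat 0 (\<lambda>_. 1)"])
    show "[0] \<in> zero_ones"
      unfolding zero_ones_def by (rule range_eqI[of _ _ 0]) simp
    show "\<exists>u\<in>zero_ones. k \<le> length u \<and> take k u = subsequence (case_nat 0 (\<lambda>_. 1)) 0 k" for k
    proof (intro bexI[of _ "0 # replicate k 1"] conjI nth_equalityI)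
      fix i assume "i < length (take k (0 # replicate k (1::nat)))"
      then show "take k (0 # replicate k 1) ! i = subsequence (case_nat 0 (\<lambda>_. 1)) 0 k ! i"
        by (cases i) auto
    qed (auto simp: zero_ones_def)
  qed (use assms in \<open>auto simp: zero_ones_def topspace_omega_words split: nat.split\<close>)
qed

theorem proposition24:
  fixes n :: nat
  assumes "n \<ge> 2"
  shows
    "(\<forall>A. A \<subseteq> lists {..<n} \<and> word_antichain A \<longrightarrow>
        omega_power A = {} \<or>
        omega_power A = topspace (omega_words n) \<or>
        closedin (omega_words n) (omega_power A) \<and> \<not> openin (omega_words n) (omega_power A) \<or>
        lightface_Pi02 n A (omega_power A) \<and> \<not> fsigma_in (omega_words n) (omega_power A)) \<and>
     (\<exists>A. A \<subseteq> lists {..<n} \<and> word_antichain A \<and> omega_power A = {}) \<and>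
     (\<exists>A. A \<subseteq> lists {..<n} \<and> word_antichain A \<and> omega_power A = topspace (omega_words n)) \<and>
     (\<exists>A. A \<subseteq> lists {..<n} \<and> word_antichain A \<and>
        closedin (omega_words n) (omega_power A) \<and> \<not> openin (omega_words n) (omega_power A)) \<and>
     (\<exists>A. A \<subseteq> lists {..<n} \<and> word_antichain A \<and>
        lightface_Pi02 n A (omega_power A) \<and> \<not> fsigma_in (omega_words n) (omega_power A)) \<and>
     (\<forall>A. A \<subseteq> lists {..<n} \<and> (\<forall>B. B \<subseteq> A \<and> word_antichain B \<longrightarrow> finite B) \<longrightarrow>
        gdelta_in (omega_words n) (omega_power A)) \<and>
     (\<exists>A. A \<subseteq> lists {..<n} \<and> (\<forall>B. B \<subseteq> A \<and> word_antichain B \<longrightarrow> finite B) \<and>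
        \<not> fsigma_in (omega_words n) (omega_power A))"
    (is "?cases \<and> ?empty \<and> ?all \<and> ?closed \<and> ?pi2 \<and> ?gdelta \<and> ?no_fsigma")
proof (intro conjI)
  have n: "0 < n"
    using assms by simp
  show ?cases
    using antichain_omega_power_cases[OF n] by blast
  show ?empty
    using omega_power_of_Nil[of "{}"] by (intro exI[of _ "{}"]) (simp add: word_antichain_def)
  show ?all
    using omega_power_letters[of n]
    by (intro exI[of _ "(\<lambda>i. [i]) ` {..<n}"]) (auto simp: word_antichain_def pairwise_def)
  show ?closed
    using zeros_closed_not_open[OF assms] n
    by (intro exI[of _ "{[0]}"]) (simp add: omega_power_singleton_letter word_antichain_def)
  have "[] \<notin> ones_zero"
    by (auto simp: ones_zero_def)
  then show ?pi2
    using ones_zero_not_fsigma[OF assms] ones_zero_antichain lightface_Pi02_omega_power[OF n] by blast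
  show ?gdelta
    using finite_antichains_imp_gdelta by metis
  show ?no_fsigma
    using zero_ones_not_fsigma[OF assms] finite_antichain_in_zero_ones by blast
qed

end
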